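(* Let $n\in\mathbb N$, $1<p<\infty$, $p\le r\le\infty$, $0<\kappa_1,\kappa_2<1$ and $\kappa=(\kappa_1+\kappa_2)/2$. There is a constant $C>0$, independent of $p$ and of the functions $F,G$, such that for all $F\in LM^{p,r;\kappa_1}(\mathbb R^n)\cap\mathrm{BMO}(\mathbb R^n)$ and $G\in LM^{p,r;\kappa_2}(\mathbb R^n)\cap\mathrm{BMO}(\mathbb R^n)$, $$\|F\cdot G\|_{M^{p;\kappa}}\le C\,p^2\Big(\|F\|_{LM^{p,r;\kappa_1}}\|G\|_{\mathrm{BMO}}+\|G\|_{LM^{p,r;\kappa_2}}\|F\|_{\mathrm{BMO}}\Big).$$
   Context: $\mathbb R^n$ carries Lebesgue measure $m$. For a ball $B\subset\mathbb R^n$ and measurable $f$ on $\mathbb R^n$, let $d_{f;B}(\lambda)=m(\{x\in B:|f(x)|>\lambda\})$ for $\lambda>0$ and $f^*_B(t)=\inf\{\lambda>0:d_{f;B}(\lambda)\le t\}$ for $t>0$ (the non-increasing rearrangement of $f\mathbf 1_B$). For $1\le p<\infty$, $1\le r\le\infty$, put $\|f\|_{L^{p,r}(B)}=\big(\int_0^\infty[s^{1/p}f_B^*(s)]^r\frac{ds}{s}\big)^{1/r}$ if $r<\infty$ and $\|f\|_{L^{p,\infty}(B)}=\sup_{s>0}s^{1/p}f_B^*(s)$. For $0<\kappa<1$, the Lorentz--Morrey space $LM^{p,r;\kappa}(\mathbb R^n)$ is the set of measurable $f$ on $\mathbb R^n$ with $\|f\|_{LM^{p,r;\kappa}}=\sup_B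 m(B)^{-\kappa/p}\|f\|_{L^{p,r}(B)}<\infty$, and the Morrey space $M^{p;\kappa}(\mathbb R^n)$ is the set of locally integrable $f$ with $\|f\|_{M^{p;\kappa}}=\sup_B\big(m(B)^{-\kappa}\int_B|f(y)|^p\,dy\big)^{1/p}<\infty$. $\mathrm{BMO}(\mathbb R^n)$ is the set of locally integrable $f$ with $\|f\|_{\mathrm{BMO}}=\sup_{B}\frac1{m(B)}\int_B|f(x)-f_B|\,dx<\infty$, with $f_B=\frac1{m(B)}\int_B f$. All suprema are over all balls $B\subset\mathbb R^n$. *)

theory Defs
  imports "HOL-Analysis.Analysis"
begin

text \<open>
  Functions take values in a type of class \<open>{real_normed_field, banach, second_countable_topology}\<close>,
  so that real-valued and complex-valued functions are both covered. Norms are \<open>ennreal\<close>-valued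
  and defined for all functions; the corresponding spaces are the sets where they are finite.
\<close>

text \<open>Powers with positive real exponent of extended nonnegative reals; only used for \<open>a > 0\<close>.\<close>

definition epow :: "ennreal \<Rightarrow> real \<Rightarrow> ennreal" where
  "epow x a = (if x = \<infinity> then \<infinity> else ennreal (enn2real x powr a))"

definition balls :: "'a::metric_space set set" where
  "balls = {ball x \<rho> | x \<rho>. 0 < \<rho>}"

definition locally_integrable ::
    "('a::euclidean_space \<Rightarrow> 'b::{banach, second_countable_topology}) \<Rightarrow> bool" where
  "locally_integrable f \<longleftrightarrow> (\<forall>K. compact K \<longrightarrow> set_integrable lebesgue K f)"

definition distr_fun ::
    "('a::euclidean_space \<Rightarrow> 'b::real_normed_vector) \<Rightarrow> 'a set \<Rightarrow> real \<Rightarrow> ennreal" where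
  "distr_fun f B l = emeasure lebesgue {x \<in> B. norm (f x) > l}"

definition rearr ::
    "('a::euclidean_space \<Rightarrow> 'b::real_normed_vector) \<Rightarrow> 'a set \<Rightarrow> real \<Rightarrow> ennreal" where
  "rearr f B t = Inf {ennreal l | l. 0 < l \<and> distr_fun f B l \<le> ennreal t}"

definition lorentz_norm ::
    "real \<Rightarrow> ennreal \<Rightarrow> 'a set \<Rightarrow> ('a::euclidean_space \<Rightarrow> 'b::real_normed_vector) \<Rightarrow> ennreal" where
  "lorentz_norm p r B f =
    (if r = \<infinity> then (SUP s\<in>{0<..}. ennreal (s powr (1 / p)) * rearr f B s)
     else epow (\<integral>\<^sup>+s\<in>{0<..}.
                  epow (ennreal (s powr (1 / p)) * rearr f B s) (enn2real r) * ennreal (1 / s)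
                \<partial>lborel) (1 / enn2real r))"

definition lorentz_morrey_norm ::
    "real \<Rightarrow> ennreal \<Rightarrow> real \<Rightarrow> ('a::euclidean_space \<Rightarrow> 'b::real_normed_vector) \<Rightarrow> ennreal" where
  "lorentz_morrey_norm p r \<kappa> f =
    (SUP B\<in>balls. ennreal (measure lebesgue B powr (- \<kappa> / p)) * lorentz_norm p r B f)"

definition lorentz_morrey ::
    "real \<Rightarrow> ennreal \<Rightarrow> real \<Rightarrow> ('a::euclidean_space \<Rightarrow> 'b::real_normed_vector) set" where
  "lorentz_morrey p r \<kappa> =
    {f. f \<in> borel_measurable lebesgue \<and> lorentz_morrey_norm p r \<kappa> f < \<infinity>}"

definition morrey_norm ::
    "real \<Rightarrow> real \<Rightarrow> ('a::euclidean_space \<Rightarrow> 'b::real_normed_vector) \<Rightarrow> ennreal" where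
  "morrey_norm p \<kappa> f =
    (SUP B\<in>balls. epow (ennreal (measure lebesgue B powr (- \<kappa>)) *
        (\<integral>\<^sup>+y\<in>B. ennreal (norm (f y) powr p) \<partial>lebesgue)) (1 / p))"

definition morrey ::
    "real \<Rightarrow> real \<Rightarrow> ('a::euclidean_space \<Rightarrow> 'b::{banach, second_countable_topology}) set" where
  "morrey p \<kappa> = {f. locally_integrable f \<and> morrey_norm p \<kappa> f < \<infinity>}"

definition ball_mean ::
    "('a::euclidean_space \<Rightarrow> 'b::{banach, second_countable_topology}) \<Rightarrow> 'a set \<Rightarrow> 'b" where
  "ball_mean f B = (1 / measure lebesgue B) *\<^sub>R (LINT x:B|lebesgue. f x)"

definition bmo_norm ::
    "('a::euclidean_space \<Rightarrow> 'b::{banach, second_countable_topology}) \<Rightarrow> ennreal" where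
  "bmo_norm f =
    (SUP B\<in>balls. ennreal (1 / measure lebesgue B) *
        (\<integral>\<^sup>+x\<in>B. ennreal (norm (f x - ball_mean f B)) \<partial>lebesgue))"

definition bmo :: "('a::euclidean_space \<Rightarrow> 'b::{banach, second_countable_topology}) set" where
  "bmo = {f. locally_integrable f \<and> bmo_norm f < \<infinity>}"

end

theory Submission
  imports Defs
begin

text \<open>
  By the Cauchy--Schwarz inequality on a ball \<open>B\<close>, the \<open>L\<^sup>p\<close> norm of the product is at most the product of
  the \<open>L\<^bsup>2p\<^esup>\<close> norms of \<open>F\<close> and \<open>G\<close>. Hence it is enough to prove the interpolation inequality
  (\<open>morrey_bmo_interpolation\<close>)
  \<open>\<integral>\<^sub>B |f|\<^bsup>2p\<^esup> \<le> (C p)\<^bsup>2p\<^esup> (N b)\<^sup>p |B|\<^bsup>\<kappa>\<^esup>\<close>, where \<open>N\<close> is a multiple of the Lorentz--Morrey norm and \<open>b\<close>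
  the BMO norm of \<open>f\<close>: multiplying the two inequalities gives \<open>p\<^sup>2\<close> times the geometric mean of the two
  terms on the right-hand side of the theorem, which is at most their sum.
  
  The Lorentz--Morrey norm enters only through the weak type bound
  \<open>|{y \<in> B. |f y| > l}| \<le> (N / l)\<^sup>p |B|\<^bsup>\<kappa>\<^esup>\<close> (\<open>lorentz_morrey_weak_type\<close>), which controls levels up to a multiple
  of \<open>b\<close>. For higher levels a relative form of the John--Nirenberg inequality is used
  (\<open>level_set_decay\<close>): if \<open>{|f| > l}\<close> has small density in a cube, then raising the level by a multiple
  of \<open>b\<close> halves its measure in the cube. Its proof covers an open superset of the level set by dyadic
  stopping cells. Let \<open>v\<^sub>0\<close> be the critical volume with \<open>N\<^sup>p v\<^sub>0\<^bsup>\<kappa> - 1\<^esup> = b\<^sup>p\<close>. On balls of volume at least \<open>v\<^sub>0\<close>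
  the weak type bound supplies the small density at a level comparable to \<open>b\<close>. On a smaller ball \<open>B\<close> the
  level sets are bounded both by \<open>|B|\<close> and by their measure in a concentric ball of volume \<open>v\<^sub>0\<close>, which
  is at most a constant times \<open>2\<^bsup>-k\<^esup> v\<^sub>0\<close> at the \<open>k\<close>-th level; the weighted geometric mean with exponents \<open>\<kappa>\<close> and \<open>1 - \<kappa>\<close>
  gives \<open>|B|\<^bsup>\<kappa>\<^esup> v\<^sub>0\<^bsup>1 - \<kappa>\<^esup>\<close> times a geometrically decaying factor, and \<open>v\<^sub>0\<^bsup>1 - \<kappa>\<^esup> = (N / b)\<^sup>p\<close> (\<open>level_set_bound\<close>).
  Summing over the levels yields the interpolation inequality; the moments of order \<open>2p\<close> of an
  exponentially decaying distribution contribute the factor \<open>(C p)\<^bsup>2p\<^esup>\<close>.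
\<close>

section \<open>Dyadic grid cells and stopping cells\<close>

text \<open>
  The cell containing \<open>x\<close> in the grid of half-open cubes of side \<open>t > 0\<close> with one vertex at \<open>a\<close>.
  Cells of equal side are the classes of an equivalence relation, and halving \<open>t\<close> refines the grid,
  so the sides \<open>s / 2 ^ k\<close> give the dyadic subdivisions of a cube of side \<open>s\<close>.
\<close>

definition grid_cell :: "'a::euclidean_space \<Rightarrow> real \<Rightarrow> 'a \<Rightarrow> 'a set" where
  "grid_cell a t x = {y. \<forall>i\<in>Basis. \<lfloor>(y - a) \<bullet> i / t\<rfloor> = \<lfloor>(x - a) \<bullet> i / t\<rfloor>}"

lemma grid_cell_self: "x \<in> grid_cell a t x"
  by (simp add: grid_cell_def)

lemma grid_cell_eq: "y \<in> grid_cell a t x \<Longrightarrow> grid_cell a t y = grid_cell a t x"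
  by (auto simp: grid_cell_def)

lemma grid_cell_half: "grid_cell a (t / 2) x \<subseteq> grid_cell a t x"
proof
  have *: "\<lfloor>u / t\<rfloor> = \<lfloor>u / (t / 2)\<rfloor> div 2" for u
  proof -
    have "u / t = u / (t / 2) / real_of_int 2" by simp
    also have "\<lfloor>\<dots>\<rfloor> = \<lfloor>u / (t / 2)\<rfloor> div 2" by (rule floor_divide_real_eq_div) simp
    finally show ?thesis .
  qed
  fix y assume y: "y \<in> grid_cell a (t / 2) x"
  show "y \<in> grid_cell a t x"
    unfolding grid_cell_def
  proof (intro CollectI ballI)
    fix i :: 'a assume "i \<in> Basis"
    then have "\<lfloor>(y - a) \<bullet> i / (t / 2)\<rfloor> = \<lfloor>(x - a) \<bullet> i / (t / 2)\<rfloor>"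
      using y by (auto simp: grid_cell_def)
    then show "\<lfloor>(y - a) \<bullet> i / t\<rfloor> = \<lfloor>(x - a) \<bullet> i / t\<rfloor>"
      using *[of "(y - a) \<bullet> i"] *[of "(x - a) \<bullet> i"] by argo
  qed
qed

lemma grid_cell_antimono:
  assumes "j \<le> k"
  shows "grid_cell a (t / 2 ^ k) x \<subseteq> grid_cell a (t / 2 ^ j) x"
  using assms
proof (induction k rule: dec_induct)
  case (step k)
  have "t / 2 ^ Suc k = t / 2 ^ k / 2" by simp
  then show ?case using step grid_cell_half by (metis order_trans)
qed simp

lemma grid_cell_conv_box:
  fixes a x :: "'a::euclidean_space" and t :: real
  assumes "t > 0"
  obtains l :: 'a where
    "grid_cell a t x = {y. \<forall>i\<in>Basis. l \<bullet> i \<le> y \<bullet> i \<and> y \<bullet> i < (l + t *\<^sub>R One) \<bullet> i}"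
proof
  let ?l = "\<Sum>i\<in>Basis. (a \<bullet> i + t * \<lfloor>(x - a) \<bullet> i / t\<rfloor>) *\<^sub>R i :: 'a"
  have "\<lfloor>(y - a) \<bullet> i / t\<rfloor> = \<lfloor>(x - a) \<bullet> i / t\<rfloor> \<longleftrightarrow>
      ?l \<bullet> i \<le> y \<bullet> i \<and> y \<bullet> i < (?l + t *\<^sub>R One) \<bullet> i" if "i \<in> Basis" for i y
  proof -
    have "?l \<bullet> i = a \<bullet> i + t * \<lfloor>(x - a) \<bullet> i / t\<rfloor>" using that by simp
    then show ?thesis
      using that assms unfolding floor_eq_iff inner_add_left inner_diff_left
      by (simp add: pos_le_divide_eq pos_divide_less_eq) (simp add: algebra_simps)
  qed
  then show "grid_cell a t x = {y. \<forall>i\<in>Basis. ?l \<bullet> i \<le> y \<bullet> i \<and> y \<bullet> i < (?l + t *\<^sub>R One) \<bullet> i}"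
    by (auto simp: grid_cell_def)
qed

lemma
  fixes a x :: "'a::euclidean_space" and t :: real
  assumes t: "t > 0"
  shows lmeasurable_grid_cell: "grid_cell a t x \<in> lmeasurable"
    and measure_grid_cell: "measure lebesgue (grid_cell a t x) = t ^ DIM('a)"
    and interior_grid_cell: "interior (grid_cell a t x) \<noteq> {}"
proof -
  obtain l where l: "grid_cell a t x = {y. \<forall>i\<in>Basis. l \<bullet> i \<le> y \<bullet> i \<and> y \<bullet> i < (l + t *\<^sub>R One) \<bullet> i}"
    using grid_cell_conv_box[OF t] by blast
  let ?u = "l + t *\<^sub>R One"
  have sub: "box l ?u \<subseteq> grid_cell a t x" "grid_cell a t x \<subseteq> cbox l ?u"
    unfolding l by (auto simp: mem_box less_imp_le)
  have "grid_cell a t x = (\<Inter>i\<in>Basis. {y. l \<bullet> i \<le> y \<bullet> i} \<inter> {y. y \<bullet> i < ?u \<bullet> i})"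
    unfolding l by auto
  also have "\<dots> \<in> sets borel"
    by (intro sets.finite_INT) auto
  finally have sets: "grid_cell a t x \<in> sets lebesgue" by simp
  then show lm: "grid_cell a t x \<in> lmeasurable"
    using sub(2) by (meson fmeasurableI2 lmeasurable_cbox)
  have c: "measure lebesgue (box l ?u) = t ^ DIM('a)" "measure lebesgue (cbox l ?u) = t ^ DIM('a)"
    using t by (simp_all add: inner_add_left)
  show "measure lebesgue (grid_cell a t x) = t ^ DIM('a)"
  proof (rule antisym)
    show "measure lebesgue (grid_cell a t x) \<le> t ^ DIM('a)"
      using measure_mono_fmeasurable[OF sub(2) sets] c by simp
    show "t ^ DIM('a) \<le> measure lebesgue (grid_cell a t x)"
      using measure_mono_fmeasurable[OF sub(1) _ lm] c by simp
  qed
  have "box l ?u \<noteq> {}" using t by (auto simp: box_ne_empty inner_add_left)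
  moreover have "box l ?u \<subseteq> interior (grid_cell a t x)"
    using interior_maximal[OF sub(1) open_box] .
  ultimately show "interior (grid_cell a t x) \<noteq> {}" by (metis subset_empty)
qed

lemma grid_cell_subset_ball:
  fixes a x :: "'a::euclidean_space" and t :: real
  assumes t: "t > 0"
  shows "grid_cell a t x \<subseteq> ball x (DIM('a) * t)"
proof
  fix y assume y: "y \<in> grid_cell a t x"
  have "\<bar>(x - y) \<bullet> i\<bar> < t" if "i \<in> Basis" for i
  proof -
    have "\<lfloor>(y - a) \<bullet> i / t\<rfloor> = \<lfloor>(x - a) \<bullet> i / t\<rfloor>" using y that by (auto simp: grid_cell_def)
    then have "\<bar>(x - a) \<bullet> i / t - (y - a) \<bullet> i / t\<bar> < 1" by linarith
    moreover have "(x - a) \<bullet> i / t - (y - a) \<bullet> i / t = (x - y) \<bullet> i / t"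
      by (simp add: inner_diff_left diff_divide_distrib)
    ultimately show ?thesis using t by (simp add: abs_divide divide_simps split: if_splits)
  qed
  then have "(\<Sum>i\<in>Basis. \<bar>(x - y) \<bullet> i\<bar>) < (\<Sum>i\<in>(Basis::'a set). t)"
    by (intro sum_strict_mono) auto
  then show "y \<in> ball x (DIM('a) * t)"
    using norm_le_l1[of "x - y"] by (simp add: dist_norm)
qed

text \<open>
  In an open set the small cells around a point are eventually contained in the set. This is what
  makes the stopping cells below cover without appeal to Lebesgue differentiation.
\<close>

lemma grid_cell_in_open:
  fixes a x :: "'a::euclidean_space" and s :: real
  assumes "open U" "x \<in> U" "s > 0"
  obtains k where "grid_cell a (s / 2 ^ k) x \<subseteq> U"
proof -
  obtain e where e: "e > 0" "ball x e \<subseteq> U" using assms by (meson open_contains_ball)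
  have "(\<lambda>k. DIM('a) * s * (1/2) ^ k) \<longlonglongrightarrow> DIM('a) * s * 0"
    by (intro tendsto_intros) auto
  then have "eventually (\<lambda>k. DIM('a) * s * (1/2) ^ k < e) sequentially"
    using e by (auto dest: order_tendstoD(2))
  then obtain k where k: "DIM('a) * s * (1/2) ^ k < e" by (auto dest: eventually_happens)
  have "grid_cell a (s / 2 ^ k) x \<subseteq> ball x (DIM('a) * (s / 2 ^ k))"
    using assms by (intro grid_cell_subset_ball) auto
  also have "\<dots> \<subseteq> ball x e" using k by (intro subset_ball) (simp add: power_one_over divide_simps)
  finally show ?thesis using that e by blast
qed

text \<open>
  The Calderon--Zygmund decomposition of an open set \<open>U\<close> of density at most \<open>\<alpha>\<close> in a cube: each point
  of \<open>U\<close> selects the largest dyadic cell around it in which \<open>U\<close> has density above \<open>\<alpha>\<close>; the parent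
  of that cell has density at most \<open>\<alpha>\<close>, which gives the upper bound.
\<close>

lemma stopping_cells:
  fixes a x\<^sub>0 :: "'a::euclidean_space" and s :: real
  assumes U: "open U" and s: "s > 0" and \<alpha>: "0 < \<alpha>" "\<alpha> < 1"
    and Q: "Q = grid_cell a s x\<^sub>0"
    and small: "measure lebesgue (U \<inter> Q) \<le> \<alpha> * s ^ DIM('a)"
  obtains \<F> where "countable \<F>" "disjoint \<F>" "U \<inter> Q \<subseteq> \<Union>\<F>" "\<Union>\<F> \<subseteq> Q"
    "\<And>D. D \<in> \<F> \<Longrightarrow> \<exists>t>0. \<exists>x. D = grid_cell a t x \<and> \<alpha> * t ^ DIM('a) < measure lebesgue (U \<inter> D) \<and>
        measure lebesgue (U \<inter> D) \<le> 2 ^ DIM('a) * \<alpha> * t ^ DIM('a)"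
proof -
  define cell where "cell k x = grid_cell a (s / 2 ^ k) x" for k :: nat and x
  define P where "P k x \<longleftrightarrow> \<alpha> * (s / 2 ^ k) ^ DIM('a) < measure lebesgue (U \<inter> cell k x)" for k x
  define \<tau> where "\<tau> x = (LEAST k. P k x)" for x
  define \<F> where "\<F> = (\<lambda>x. cell (\<tau> x) x) ` (U \<inter> Q)"
  have cell0: "cell 0 x = Q" if "x \<in> Q" for x
    using that grid_cell_eq[of x a s x\<^sub>0] by (simp add: cell_def Q)
  have lm: "U \<inter> cell k x \<in> lmeasurable" for k x
    using U s by (auto simp: cell_def intro!: fmeasurable_Int_fmeasurable lmeasurable_grid_cell
      simp: Int_commute[of U])
  have self: "x \<in> cell k x" for x k by (simp add: cell_def grid_cell_self)
  have P\<tau>: "P (\<tau> x) x" if xU: "x \<in> U" for x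
  proof -
    obtain k where k: "cell k x \<subseteq> U"
      using grid_cell_in_open[OF U xU s] by (auto simp: cell_def)
    have "P k x" using k s \<alpha> 
      by (simp add: P_def Int_absorb1) (simp add: cell_def measure_grid_cell)
    then show ?thesis unfolding \<tau>_def by (rule LeastI)
  qed
  have \<tau>_le: "\<tau> x \<le> k" if "P k x" for x k using that by (auto simp: \<tau>_def intro: Least_le)
  have eq: "cell (\<tau> x) x = cell (\<tau> y) y"
    if "x \<in> U" "y \<in> U" "z \<in> cell (\<tau> x) x" "z \<in> cell (\<tau> y) y" "\<tau> x \<le> \<tau> y" for x y z
  proof -
    have "z \<in> cell (\<tau> x) y" using that(4) grid_cell_antimono[OF that(5), of a s y] by (auto simp: cell_def)
    then have "cell (\<tau> x) x = cell (\<tau> x) y" using that(3) grid_cell_eq by (metis cell_def)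
    moreover from this have "P (\<tau> x) y" using P\<tau>[OF that(1)] by (simp add: P_def)
    then have "\<tau> y = \<tau> x" using \<tau>_le that(5) by force
    ultimately show ?thesis by simp
  qed
  have disj: "disjoint \<F>"
    unfolding disjoint_def
  proof (intro ballI impI)
    fix A B assume "A \<in> \<F>" "B \<in> \<F>" "A \<noteq> B"
    then obtain x y where xy: "x \<in> U" "y \<in> U" "A = cell (\<tau> x) x" "B = cell (\<tau> y) y"
      by (auto simp: \<F>_def)
    have False if z: "z \<in> A" "z \<in> B" for z
      using eq[of x y z] eq[of y x z] xy \<open>A \<noteq> B\<close> z by (cases "\<tau> x \<le> \<tau> y") auto
    then show "A \<inter> B = {}" by auto
  qed
  show thesis
  proof
    show "disjoint \<F>" by fact
    show "countable \<F>"
    proof (rule countable_disjoint_nonempty_interior_subsets)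
      show "pairwise disjnt \<F>" using disj by (simp add: disjoint_def pairwise_def disjnt_def)
      show "\<And>S. S \<in> \<F> \<Longrightarrow> interior S = {} \<Longrightarrow> S = {}"
        using s by (auto simp: \<F>_def cell_def interior_grid_cell)
    qed
    show "U \<inter> Q \<subseteq> \<Union>\<F>" using self by (auto simp: \<F>_def)
    show "\<Union>\<F> \<subseteq> Q"
    proof -
      have "cell k x \<subseteq> Q" if "x \<in> Q" for x k
        using cell0[OF that] grid_cell_antimono[of 0 k a s x] by (simp add: cell_def)
      then show ?thesis by (auto simp: \<F>_def)
    qed
    fix D assume "D \<in> \<F>"
    then obtain x where x: "x \<in> U" "x \<in> Q" "D = cell (\<tau> x) x" by (auto simp: \<F>_def)
    \<comment> \<open>level 0 is the whole cube, so every stopping cell has a parent inside the cube\<close>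
    have "\<not> P 0 x" using small cell0[OF x(2)] by (simp add: P_def)
    then obtain j where j: "\<tau> x = Suc j" using P\<tau>[OF x(1)] by (metis not0_implies_Suc)
    have "\<not> P j x" using \<tau>_le[of j x] j by auto
    have "cell (\<tau> x) x \<subseteq> cell j x"
      using grid_cell_antimono[of j "Suc j" a s x] j by (simp add: cell_def)
    then have "measure lebesgue (U \<inter> D) \<le> measure lebesgue (U \<inter> cell j x)"
      using lm x(3) by (intro measure_mono_fmeasurable) (auto intro: fmeasurableD)
    also have "\<dots> \<le> \<alpha> * (s / 2 ^ j) ^ DIM('a)" using \<open>\<not> P j x\<close> by (simp add: P_def)
    also have "\<dots> = \<alpha> * (2 * (s / 2 ^ Suc j)) ^ DIM('a)" by simp
    also have "\<dots> = 2 ^ DIM('a) * \<alpha> * (s / 2 ^ Suc j) ^ DIM('a)"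
      unfolding power_mult_distrib by simp
    finally show "\<exists>t>0. \<exists>x. D = grid_cell a t x \<and> \<alpha> * t ^ DIM('a) < measure lebesgue (U \<inter> D) \<and>
        measure lebesgue (U \<inter> D) \<le> 2 ^ DIM('a) * \<alpha> * t ^ DIM('a)"
      using P\<tau>[OF x(1)] x(3) j s
      by (intro exI[of _ "s / 2 ^ \<tau> x"] conjI exI[of _ x]) (auto simp: P_def cell_def)
  qed
qed

section \<open>Exponential decay of level sets under bounded mean oscillation\<close>

text \<open>
  The mean oscillation of \<open>f\<close> over every ball is at most \<open>b\<close>, where the mean is replaced by some
  constant that may depend on the ball.
\<close>

definition bounded_oscillation ::
    "('a::euclidean_space \<Rightarrow> 'b::real_normed_vector) \<Rightarrow> real \<Rightarrow> bool" where
  "bounded_oscillation f b \<longleftrightarrow> (\<forall>x \<rho>. \<rho> > 0 \<longrightarrow> (\<exists>c.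
     (\<integral>\<^sup>+y\<in>ball x \<rho>. ennreal (norm (f y - c)) \<partial>lebesgue) \<le> ennreal (b * measure lebesgue (ball x \<rho>))))"

lemma measure_ball_scale:
  fixes x :: "'a::euclidean_space"
  assumes "M \<ge> 0" "r \<ge> 0"
  shows "measure lebesgue (ball x (M * r)) = measure lebesgue (ball (0::'a) M) * r ^ DIM('a)"
  using assms by (simp add: content_ball power_mult_distrib)

lemma markov_measure:
  assumes h: "h \<in> borel_measurable lebesgue" and B: "B \<in> sets lebesgue" and D: "D \<in> sets lebesgue" "D \<subseteq> B"
    and I: "(\<integral>\<^sup>+y\<in>B. ennreal (h y) \<partial>lebesgue) \<le> ennreal I" and s: "s > 0" and I0: "I \<ge> 0"
  shows "measure lebesgue {y \<in> D. s \<le> h y} \<le> I / s"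
proof -
  have m: "{y \<in> D. s \<le> h y} \<in> sets lebesgue"
  proof -
    have "{y \<in> D. s \<le> h y} = D \<inter> {y \<in> space lebesgue. s \<le> h y}" by auto
    also have "\<dots> \<in> sets lebesgue" using h D by measurable
    finally show ?thesis .
  qed
  have "ennreal s * emeasure lebesgue {y \<in> D. s \<le> h y}
      = (\<integral>\<^sup>+y. ennreal s * indicator {y \<in> D. s \<le> h y} y \<partial>lebesgue)"
    using m by (simp add: nn_integral_cmult_indicator)
  also have "\<dots> \<le> (\<integral>\<^sup>+y\<in>B. ennreal (h y) \<partial>lebesgue)"
    using D by (intro nn_integral_mono) (auto simp: indicator_def ennreal_leI)
  also note I
  finally have *: "ennreal s * emeasure lebesgue {y \<in> D. s \<le> h y} \<le> ennreal I" .
  then have "emeasure lebesgue {y \<in> D. s \<le> h y} \<noteq> \<infinity>"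
    using s by (auto simp: ennreal_mult_top top_unique)
  then have "emeasure lebesgue {y \<in> D. s \<le> h y} = ennreal (measure lebesgue {y \<in> D. s \<le> h y})"
    by (simp add: emeasure_eq_ennreal_measure)
  with * have "s * measure lebesgue {y \<in> D. s \<le> h y} \<le> I"
    using s I0 by (simp add: ennreal_mult[symmetric])
  then show ?thesis using s by (simp add: pos_le_divide_eq mult.commute)
qed

lemma level_set_sets:
  fixes f :: "'a::euclidean_space \<Rightarrow> 'b::{real_normed_vector,second_countable_topology}"
  assumes "f \<in> borel_measurable lebesgue" "D \<in> sets lebesgue"
  shows "{y \<in> D. l < norm (f y)} \<in> sets lebesgue"
proof -
  have "{y \<in> D. l < norm (f y)} = D \<inter> {y \<in> space lebesgue. l < norm (f y)}" by auto
  also have "\<dots> \<in> sets lebesgue" using assms by measurable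
  finally show ?thesis .
qed

text \<open>
  A cell in which \<open>norm f \<le> l\<close> on at least half of the volume: the constant approximating \<open>f\<close> is
  then close to size \<open>l\<close>, and the part of the cell where \<open>f\<close> is much larger is small by Markov's
  inequality. \<open>A\<close> is the volume ratio between the ball around the cell and the cell.
\<close>

lemma cell_level_estimate:
  fixes f :: "'a::euclidean_space \<Rightarrow> 'b::{real_normed_vector,second_countable_topology}"
    and a x :: 'a and b t K :: real
  defines "A \<equiv> measure lebesgue (ball (0::'a) DIM('a))"
  assumes f: "f \<in> borel_measurable lebesgue" and osc: "bounded_oscillation f b" and b: "b > 0"
    and t: "t > 0" and D: "D = grid_cell a t x"
    and U: "U \<in> sets lebesgue" "measure lebesgue (U \<inter> D) \<le> t ^ DIM('a) / 2"
    and lev: "\<And>y. y \<in> D - U \<Longrightarrow> norm (f y) \<le> l" and K: "K > 4 * A"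
  shows "measure lebesgue {y \<in> D. l + K * b < norm (f y)} \<le> A / (K - 4 * A) * t ^ DIM('a)"
proof -
  define B where "B = ball x (DIM('a) * t)"
  have mB: "measure lebesgue B = A * t ^ DIM('a)"
    using t by (simp only: B_def A_def measure_ball_scale of_nat_0_le_iff less_imp_le)
  have A0: "A > 0" by (simp add: A_def content_ball)
  have DB: "D \<subseteq> B" using t by (simp add: D B_def grid_cell_subset_ball)
  have Dl: "D \<in> lmeasurable" "measure lebesgue D = t ^ DIM('a)"
    using t by (simp_all add: D lmeasurable_grid_cell measure_grid_cell)
  obtain c where c: "(\<integral>\<^sup>+y\<in>B. ennreal (norm (f y - c)) \<partial>lebesgue) \<le> ennreal (b * (A * t ^ DIM('a)))"
  proof -
    have "DIM('a) * t > 0" using t by simp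
    then show ?thesis
      using osc that unfolding bounded_oscillation_def mB[symmetric] B_def by blast
  qed
  have h: "(\<lambda>y. norm (f y - c)) \<in> borel_measurable lebesgue" using f by measurable
  have mk: "measure lebesgue {y \<in> D. s \<le> norm (f y - c)} \<le> b * (A * t ^ DIM('a)) / s" if "s > 0" for s
    using that A0 b t Dl c DB by (intro markov_measure[OF h]) (auto simp: B_def fmeasurableD)
  have W: "{y \<in> D. s \<le> norm (f y - c)} \<in> lmeasurable" for s
  proof -
    have "{y \<in> D. s \<le> norm (f y - c)} = D \<inter> {y \<in> space lebesgue. s \<le> norm (f y - c)}" by auto
    also have "\<dots> \<in> lmeasurable"
      using borel_measurable_le[OF borel_measurable_const h]
      by (intro fmeasurable_Int_fmeasurable Dl) simp
    finally show ?thesis .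
  qed
  \<comment> \<open>the set outside \<open>U\<close> has volume at least one half, the set of large oscillation at most one quarter\<close>
  have "\<exists>y \<in> D - U. norm (f y - c) < 4 * A * b"
  proof (rule ccontr)
    assume "\<not> ?thesis"
    then have "D - U \<subseteq> {y \<in> D. 4 * A * b \<le> norm (f y - c)}" by force
    then have "measure lebesgue (D - U) \<le> measure lebesgue {y \<in> D. 4 * A * b \<le> norm (f y - c)}"
      using Dl U by (intro measure_mono_fmeasurable W) (auto simp: fmeasurableD)
    also have "\<dots> \<le> b * (A * t ^ DIM('a)) / (4 * A * b)" using A0 b by (intro mk) auto
    also have "\<dots> = t ^ DIM('a) / 4" using A0 b by simp
    finally have "measure lebesgue (D - U) \<le> t ^ DIM('a) / 4" .
    moreover have "measure lebesgue (D - U) = measure lebesgue D - measure lebesgue (U \<inter> D)"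
    proof -
      have "D - U = D - U \<inter> D" by auto
      then show ?thesis
        using measurable_measure_Diff[of D lebesgue "U \<inter> D"] Dl U by (simp add: fmeasurableD)
    qed
    moreover have "t ^ DIM('a) > 0" using t by simp
    ultimately show False using U(2) Dl(2) by simp
  qed
  then obtain y where y: "y \<in> D - U" "norm (f y - c) < 4 * A * b" by blast
  have "norm c < l + 4 * A * b"
    using lev[OF y(1)] y(2) norm_triangle_ineq2[of c "f y"] by (simp add: norm_minus_commute)
  then have "(K - 4 * A) * b \<le> norm (f z - c)" if "l + K * b < norm (f z)" for z
    using that norm_triangle_ineq2[of "f z" c] by (simp add: algebra_simps)
  then have "{y \<in> D. l + K * b < norm (f y)} \<subseteq> {y \<in> D. (K - 4 * A) * b \<le> norm (f y - c)}"
    by auto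
  then have "measure lebesgue {y \<in> D. l + K * b < norm (f y)} \<le>
      measure lebesgue {y \<in> D. (K - 4 * A) * b \<le> norm (f y - c)}"
    using f Dl by (intro measure_mono_fmeasurable W level_set_sets) (auto simp: fmeasurableD)
  also have "\<dots> \<le> b * (A * t ^ DIM('a)) / ((K - 4 * A) * b)" using K b by (intro mk) auto
  also have "\<dots> = A / (K - 4 * A) * t ^ DIM('a)" using K b by simp
  finally show ?thesis .
qed

text \<open>
  One step of the John--Nirenberg argument. In contrast to the usual form it starts from a level set
  of small density, with no mean value involved, and the bound is by the measure of the level set
  and not of the cube. This relative form can be combined with a weak type estimate.
\<close>

lemma level_set_decay_step:
  fixes f :: "'a::euclidean_space \<Rightarrow> 'b::{real_normed_vector,second_countable_topology}"
    and a x :: 'a and b s K :: real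
  assumes f: "f \<in> borel_measurable lebesgue" and osc: "bounded_oscillation f b" and b: "b > 0"
    and s: "s > 0" and Q: "Q = grid_cell a s x"
    and K: "K = 4 * (1 + 2 ^ (DIM('a) + 1)) * measure lebesgue (ball (0::'a) DIM('a))"
    and small: "measure lebesgue {y \<in> Q. l < norm (f y)} \<le> s ^ DIM('a) / 2 ^ (DIM('a) + 2)"
  shows "measure lebesgue {y \<in> Q. l + K * b < norm (f y)} \<le> measure lebesgue {y \<in> Q. l < norm (f y)} / 2"
proof -
  define A where "A = measure lebesgue (ball (0::'a) DIM('a))"
  define \<alpha> :: real where "\<alpha> = 1 / 2 ^ (DIM('a) + 1)"
  define E where "E = {y \<in> Q. l < norm (f y)}"
  define E' where "E' = {y \<in> Q. l + K * b < norm (f y)}"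
  have A0: "A > 0" by (simp add: A_def content_ball)
  have K': "K = 4 * A + 4 * A / \<alpha>" by (simp add: K A_def \<alpha>_def algebra_simps)
  then have K4: "K > 4 * A" "A / (K - 4 * A) = \<alpha> / 4" using A0 by (auto simp: \<alpha>_def)
  then have "K > 0" using A0 by linarith
  have Ql: "Q \<in> lmeasurable" using s by (simp add: Q lmeasurable_grid_cell)
  have Es: "E \<in> lmeasurable" "E' \<in> lmeasurable"
    unfolding E_def E'_def
    by (rule fmeasurableI2[OF Ql _ level_set_sets[OF f fmeasurableD[OF Ql]]], blast)+
  have E'E: "E' \<subseteq> E"
  proof -
    have "K * b > 0" using \<open>K > 0\<close> b by simp
    then show ?thesis by (auto simp: E_def E'_def)
  qed
  have "measure lebesgue E' \<le> measure lebesgue E / 2"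
  proof (cases "measure lebesgue E = 0")
    case True
    then show ?thesis
      using measure_mono_fmeasurable[OF E'E fmeasurableD[OF Es(2)] Es(1)] by simp
  next
    case False
    then have pos: "measure lebesgue E > 0" by (simp add: zero_less_measure_iff)
    \<comment> \<open>outer regularity; doubling the measure is harmless since the cells gain a factor 1/4\<close>
    obtain U where U: "open U" "E \<subseteq> U" and UE: "U - E \<in> lmeasurable"
        "emeasure lebesgue (U - E) < ennreal (measure lebesgue E)"
      using sets_lebesgue_outer_open[OF fmeasurableD[OF Es(1)] pos] by metis
    have U_eq: "U = E \<union> (U - E)" using U(2) by blast
    have "U \<in> lmeasurable" using fmeasurable.Un[OF Es(1) UE(1)] U_eq by simp
    moreover have "measure lebesgue (U - E) < measure lebesgue E"
      using UE by (simp add: emeasure_eq_measure2 ennreal_less_iff)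
    then have "measure lebesgue U < measure lebesgue E + measure lebesgue E"
      using measure_Un_le[of E lebesgue "U - E"] Es(1) UE(1) U_eq by (simp add: fmeasurableD)
    ultimately have U: "open U" "E \<subseteq> U" "U \<in> lmeasurable"
        "measure lebesgue U < measure lebesgue E + measure lebesgue E" using U by auto
    have UQ: "measure lebesgue (U \<inter> Q) \<le> \<alpha> * s ^ DIM('a)"
    proof -
      have "measure lebesgue (U \<inter> Q) \<le> measure lebesgue U"
        using U Ql by (intro measure_mono_fmeasurable) (auto simp: fmeasurableD)
      also have "\<dots> \<le> 2 * (s ^ DIM('a) / 2 ^ (DIM('a) + 2))" using U(4) small by (simp add: E_def)
      also have "\<dots> = \<alpha> * s ^ DIM('a)" by (simp add: \<alpha>_def)
      finally show ?thesis .
    qed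
    have \<alpha>: "0 < \<alpha>" "\<alpha> < 1"
      using one_less_power[of "2::real" "DIM('a) + 1"] by (simp_all add: \<alpha>_def)
    from stopping_cells[OF U(1) s \<alpha> Q UQ] obtain \<F> where
      \<F>: "countable \<F>" "disjoint \<F>" "U \<inter> Q \<subseteq> \<Union>\<F>" "\<Union>\<F> \<subseteq> Q"
      and cells: "\<And>D. D \<in> \<F> \<Longrightarrow> \<exists>t>0. \<exists>x. D = grid_cell a t x \<and> \<alpha> * t ^ DIM('a) < measure lebesgue (U \<inter> D) \<and>
        measure lebesgue (U \<inter> D) \<le> 2 ^ DIM('a) * \<alpha> * t ^ DIM('a)" by metis
    have Dl: "D \<in> lmeasurable" if "D \<in> \<F>" for D
      using cells[OF that] lmeasurable_grid_cell by auto
    have loc: "emeasure lebesgue (E' \<inter> D) \<le> ennreal (1/4) * emeasure lebesgue (U \<inter> D)" if D: "D \<in> \<F>" for D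
    proof -
      obtain t x' where t: "t > 0" "D = grid_cell a t x'" "\<alpha> * t ^ DIM('a) < measure lebesgue (U \<inter> D)"
        "measure lebesgue (U \<inter> D) \<le> 2 ^ DIM('a) * \<alpha> * t ^ DIM('a)" using cells[OF D] by blast
      have DQ: "D \<subseteq> Q" using D \<F>(4) by blast
      have "measure lebesgue {y \<in> D. l + K * b < norm (f y)} \<le> A / (K - 4 * A) * t ^ DIM('a)"
        unfolding A_def
      proof (rule cell_level_estimate[OF f osc b t(1,2)])
        show "measure lebesgue (U \<inter> D) \<le> t ^ DIM('a) / 2" using t(4) by (simp add: \<alpha>_def)
        show "\<And>y. y \<in> D - U \<Longrightarrow> norm (f y) \<le> l" using U(2) DQ by (force simp: E_def)
      qed (use U K4 in \<open>auto simp: A_def fmeasurableD\<close>)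
      also have "\<dots> \<le> 1/4 * measure lebesgue (U \<inter> D)" unfolding K4(2) using t(3) by simp
      also have "{y \<in> D. l + K * b < norm (f y)} = E' \<inter> D" using DQ by (auto simp: E'_def)
      finally have "ennreal (measure lebesgue (E' \<inter> D)) \<le> ennreal (1/4 * measure lebesgue (U \<inter> D))"
        by (rule ennreal_leI)
      moreover have "E' \<inter> D \<in> lmeasurable" "U \<inter> D \<in> lmeasurable" using Es U Dl[OF D] by auto
      ultimately show ?thesis
        by (simp add: emeasure_eq_measure2 ennreal_mult[symmetric] del: ennreal_mult'')
    qed
    have dj: "disjoint_family_on (\<lambda>D. X \<inter> D) \<F>" for X
      using \<F>(2) by (auto simp: disjoint_family_on_def disjoint_def)
    have "E' = (\<Union>D\<in>\<F>. E' \<inter> D)" using E'E U(2) \<F>(3) by (auto simp: E_def E'_def)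
    then have "emeasure lebesgue E' = emeasure lebesgue (\<Union>D\<in>\<F>. E' \<inter> D)" by simp
    also have "\<dots> = (\<integral>\<^sup>+D. emeasure lebesgue (E' \<inter> D) \<partial>count_space \<F>)"
      using Es Dl \<F>(1) dj by (intro emeasure_UN_countable) (auto simp: fmeasurableD)
    also have "\<dots> \<le> (\<integral>\<^sup>+D. ennreal (1/4) * emeasure lebesgue (U \<inter> D) \<partial>count_space \<F>)"
      by (intro nn_integral_mono) (use loc in auto)
    also have "\<dots> = ennreal (1/4) * (\<integral>\<^sup>+D. emeasure lebesgue (U \<inter> D) \<partial>count_space \<F>)"
      by (intro nn_integral_cmult) auto
    also have "(\<integral>\<^sup>+D. emeasure lebesgue (U \<inter> D) \<partial>count_space \<F>) = emeasure lebesgue (\<Union>D\<in>\<F>. U \<inter> D)"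
      using U Dl \<F>(1) dj by (intro emeasure_UN_countable[symmetric]) (auto simp: fmeasurableD)
    also have "\<dots> \<le> emeasure lebesgue U"
      using U by (intro emeasure_mono) (auto simp: fmeasurableD)
    finally have "emeasure lebesgue E' \<le> ennreal (1/4) * emeasure lebesgue U"
      by (simp add: mult_left_mono)
    then have "measure lebesgue E' \<le> 1/4 * measure lebesgue U"
      using Es U by (simp add: emeasure_eq_measure2 ennreal_mult[symmetric] del: ennreal_mult'')
    then show ?thesis using U(4) by simp
  qed
  then show ?thesis by (simp add: E_def E'_def)
qed

lemma level_set_decay:
  fixes f :: "'a::euclidean_space \<Rightarrow> 'b::{real_normed_vector,second_countable_topology}"
    and a x :: 'a and b s K :: real
  assumes f: "f \<in> borel_measurable lebesgue" and osc: "bounded_oscillation f b" and b: "b > 0"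
    and s: "s > 0" and Q: "Q = grid_cell a s x"
    and K: "K = 4 * (1 + 2 ^ (DIM('a) + 1)) * measure lebesgue (ball (0::'a) DIM('a))"
    and small: "measure lebesgue {y \<in> Q. l < norm (f y)} \<le> s ^ DIM('a) / 2 ^ (DIM('a) + 2)"
  shows "measure lebesgue {y \<in> Q. l + k * (K * b) < norm (f y)} \<le> measure lebesgue {y \<in> Q. l < norm (f y)} / 2 ^ k"
proof (induction k)
  case (Suc k)
  have "measure lebesgue {y \<in> Q. l < norm (f y)} / 2 ^ k \<le> measure lebesgue {y \<in> Q. l < norm (f y)}"
    using mult_left_mono[of 1 "2 ^ k :: real" "measure lebesgue {y \<in> Q. l < norm (f y)}"]
    by (simp add: divide_le_eq)
  with Suc small have small': "measure lebesgue {y \<in> Q. l + k * (K * b) < norm (f y)} \<le> s ^ DIM('a) / 2 ^ (DIM('a) + 2)"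
    by linarith
  have "measure lebesgue {y \<in> Q. (l + k * (K * b)) + K * b < norm (f y)} \<le>
      measure lebesgue {y \<in> Q. l + k * (K * b) < norm (f y)} / 2"
    by (rule level_set_decay_step[OF f osc b s Q K small'])
  moreover have "(l + k * (K * b)) + K * b = l + Suc k * (K * b)" by (simp add: algebra_simps)
  ultimately show ?case using Suc by simp
qed simp

section \<open>Weak type estimates from the Lorentz--Morrey norm\<close>

lemma epow_mono:
  assumes "ennreal m \<le> x" "0 \<le> m" "0 \<le> a"
  shows "ennreal (m powr a) \<le> epow x a"
proof (cases x)
  case (real y)
  then show ?thesis using assms by (auto simp: epow_def intro!: ennreal_leI powr_mono2)
qed (simp add: epow_def)

lemma epow_le_ennreal_iff:
  assumes "a > 0" "L \<ge> 0"
  shows "epow x a \<le> ennreal L \<longleftrightarrow> x \<le> ennreal (L powr (1 / a))"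
proof (cases x)
  case (real y)
  have "y powr a \<le> L \<longleftrightarrow> y \<le> L powr (1 / a)"
  proof
    assume "y powr a \<le> L"
    then have "(y powr a) powr (1 / a) \<le> L powr (1 / a)" using assms by (intro powr_mono2) auto
    then show "y \<le> L powr (1 / a)" using real assms by (simp add: powr_powr)
  next
    assume "y \<le> L powr (1 / a)"
    then have "y powr a \<le> (L powr (1 / a)) powr a" using assms real by (intro powr_mono2) auto
    then show "y powr a \<le> L" using real assms by (simp add: powr_powr)
  qed
  then show ?thesis using real assms by (simp add: epow_def)
qed (simp add: epow_def top_unique)

lemma rearr_lower_bound:
  fixes f :: "'a::euclidean_space \<Rightarrow> 'b::{real_normed_vector,second_countable_topology}"
  assumes f: "f \<in> borel_measurable lebesgue" and B: "B \<in> lmeasurable"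
    and s: "0 \<le> s" "s < measure lebesgue {x \<in> B. l < norm (f x)}"
  shows "ennreal l \<le> rearr f B s"
  unfolding rearr_def
proof (rule Inf_greatest, clarify)
  fix l' assume l': "0 < l'" "distr_fun f B l' \<le> ennreal s"
  have sets: "{x \<in> B. t < norm (f x)} \<in> sets lebesgue" for t
    using f B by (intro level_set_sets) (auto simp: fmeasurableD)
  have "{x \<in> B. l < norm (f x)} \<in> lmeasurable"
    using fmeasurableI2[OF B _ sets] by blast
  then have "ennreal s < emeasure lebesgue {x \<in> B. l < norm (f x)}"
    using s by (simp add: emeasure_eq_measure2 ennreal_less_iff)
  then have lt: "distr_fun f B l' < emeasure lebesgue {x \<in> B. l < norm (f x)}" using l'(2) by simp
  show "ennreal l \<le> ennreal l'"
  proof (rule ccontr)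
    assume "\<not> ?thesis"
    then have "l' < l" using l' by (meson ennreal_leI not_le)
    then have "emeasure lebesgue {x \<in> B. l < norm (f x)} \<le> distr_fun f B l'"
      unfolding distr_fun_def using sets by (intro emeasure_mono) auto
    then show False using lt by simp
  qed
qed

text \<open>
  The embedding of \<open>L\<^bsup>p,r\<^esup>\<close> into weak \<open>L\<^sup>p\<close>, with constants independent of \<open>p\<close> and \<open>r\<close>: below the measure
  \<open>d\<close> of the level set the rearrangement is at least \<open>l\<close>, and it suffices to look at \<open>d/2 < s < d\<close>.
\<close>

lemma lorentz_norm_weak_type:
  fixes f :: "'a::euclidean_space \<Rightarrow> 'b::{real_normed_vector,second_countable_topology}"
  assumes p: "p > 0" and r: "1 \<le> r" and f: "f \<in> borel_measurable lebesgue"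
    and B: "B \<in> lmeasurable" and l: "l > 0"
    and L: "lorentz_norm p r B f \<le> ennreal L" "L \<ge> 0"
  shows "measure lebesgue {x \<in> B. l < norm (f x)} \<le> 2 * (2 * L / l) powr p"
proof -
  define d where "d = measure lebesgue {x \<in> B. l < norm (f x)}"
  define m where "m = (d / 2) powr (1 / p) * l"
  have "d \<le> 2 * (2 * L / l) powr p"
  proof (cases "d = 0")
    case False
    then have d: "d > 0" using measure_nonneg[of lebesgue] by (simp add: d_def zero_less_measure_iff)
    have m0: "m > 0" using d l by (simp add: m_def)
    have low: "ennreal m \<le> ennreal (s powr (1 / p)) * rearr f B s" if "d / 2 < s" "s < d" for s
    proof -
      have "ennreal m \<le> ennreal (s powr (1 / p) * l)"
        unfolding m_def using that p l d by (intro ennreal_leI mult_right_mono powr_mono2) auto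
      also have "\<dots> = ennreal (s powr (1 / p)) * ennreal l" using l by (simp add: ennreal_mult)
      also have "\<dots> \<le> ennreal (s powr (1 / p)) * rearr f B s"
        using that d by (intro mult_left_mono rearr_lower_bound[OF f B]) (auto simp: d_def)
      finally show ?thesis .
    qed
    have "m \<le> 2 * L"
    proof (cases "r = \<infinity>")
      case True
      have "ennreal m \<le> ennreal ((3/4 * d) powr (1 / p)) * rearr f B (3/4 * d)"
        using d by (intro low) auto
      also have "\<dots> \<le> lorentz_norm p r B f"
        unfolding lorentz_norm_def using True d by (auto intro!: SUP_upper2[of "3/4 * d"])
      also note L(1)
      finally show ?thesis using L(2) m0 by simp
    next
      case False
      define q where "q = enn2real r"
      have q: "q \<ge> 1" using r False
        by (cases r) (auto simp: q_def)
      have "ennreal (m powr q / 2) = ennreal (m powr q * (1 / d) * (d / 2))" using d by simp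
      also have "\<dots> = (\<integral>\<^sup>+s. ennreal (m powr q * (1 / d)) * indicator {d / 2<..<d} s \<partial>lborel)"
        using d by (subst nn_integral_cmult_indicator) (auto simp: ennreal_mult[symmetric])
      also have "\<dots> \<le> (\<integral>\<^sup>+s\<in>{0<..}. epow (ennreal (s powr (1 / p)) * rearr f B s) q * ennreal (1 / s) \<partial>lborel)"
      proof (intro nn_integral_mono)
        fix s :: real
        show "ennreal (m powr q * (1 / d)) * indicator {d / 2<..<d} s \<le>
          epow (ennreal (s powr (1 / p)) * rearr f B s) q * ennreal (1 / s) * indicator {0<..} s"
        proof (cases "s \<in> {d / 2<..<d}")
          case True
          then have s: "d / 2 < s" "s < d" "0 < s" using d by auto
          have "ennreal (m powr q * (1 / d)) = ennreal (m powr q) * ennreal (1 / d)"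
            using d by (intro ennreal_mult) auto
          also have "\<dots> \<le> epow (ennreal (s powr (1 / p)) * rearr f B s) q * ennreal (1 / s)"
            using s d m0 q by (intro mult_mono epow_mono low ennreal_leI divide_left_mono) auto
          finally show ?thesis using True s by simp
        qed simp
      qed
      also have "\<dots> \<le> ennreal (L powr q)"
        using L q False epow_le_ennreal_iff[of "1 / q" L] unfolding lorentz_norm_def q_def[symmetric] by simp
      finally have "m powr q / 2 \<le> L powr q" by simp
      then have "m powr q \<le> 2 powr 1 * L powr q" by simp
      also have "\<dots> \<le> 2 powr q * L powr q" using q by (intro mult_right_mono powr_mono) auto
      also have "\<dots> = (2 * L) powr q" using L by (simp add: powr_mult)
      finally show ?thesis
        using powr_less_mono2[of q "2 * L" m] q L m0 by (meson leD leI le_less_trans mult_nonneg_nonneg not_one_le_zero order_less_le_trans zero_le_numeral zero_less_one)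
    qed
    then have "(d / 2) powr (1 / p) \<le> 2 * L / l" using l by (simp add: m_def pos_le_divide_eq)
    then have "((d / 2) powr (1 / p)) powr p \<le> (2 * L / l) powr p" using p by (intro powr_mono2) auto
    then show ?thesis using p d by (simp add: powr_powr)
  qed simp
  then show ?thesis by (simp add: d_def)
qed

text \<open>
  The weak Morrey condition: on every ball \<open>B\<close> the function satisfies the weak \<open>L\<^sup>p\<close> bound with constant
  \<open>N * |B| powr (\<kappa> / p)\<close>.
\<close>

definition weak_morrey ::
    "real \<Rightarrow> real \<Rightarrow> real \<Rightarrow> ('a::euclidean_space \<Rightarrow> 'b::real_normed_vector) \<Rightarrow> bool" where
  "weak_morrey p \<kappa> N f \<longleftrightarrow> (\<forall>x \<rho> l. \<rho> > 0 \<longrightarrow> l > 0 \<longrightarrow>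
     measure lebesgue {y \<in> ball x \<rho>. l < norm (f y)} \<le>
       (N / l) powr p * measure lebesgue (ball x \<rho>) powr \<kappa>)"

lemma lorentz_morrey_weak_type:
  fixes f :: "'a::euclidean_space \<Rightarrow> 'b::{real_normed_vector,second_countable_topology}"
  assumes p: "p \<ge> 1" and r: "1 \<le> r" and f: "f \<in> borel_measurable lebesgue"
    and L: "lorentz_morrey_norm p r \<kappa> f \<le> ennreal L" "L \<ge> 0"
  shows "weak_morrey p \<kappa> (4 * L) f"
  unfolding weak_morrey_def
proof (intro allI impI)
  fix x :: 'a and \<rho> l :: real assume \<rho>: "\<rho> > 0" and l: "l > 0"
  define v where "v = measure lebesgue (ball x \<rho>)"
  have v: "v > 0" using \<rho> by (simp add: v_def)
  have "ball x \<rho> \<in> balls" using \<rho> by (auto simp: balls_def)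
  then have "ennreal (v powr (- \<kappa> / p)) * lorentz_norm p r (ball x \<rho>) f \<le> lorentz_morrey_norm p r \<kappa> f"
    unfolding lorentz_morrey_norm_def v_def by (rule SUP_upper)
  also note L(1)
  finally have "ennreal (v powr (- \<kappa> / p)) * lorentz_norm p r (ball x \<rho>) f \<le> ennreal L" .
  then have "ennreal (v powr (\<kappa> / p)) * (ennreal (v powr (- \<kappa> / p)) * lorentz_norm p r (ball x \<rho>) f)
      \<le> ennreal (v powr (\<kappa> / p)) * ennreal L"
    by (intro mult_left_mono) auto
  moreover have "ennreal (v powr (\<kappa> / p)) * ennreal (v powr (- \<kappa> / p)) = 1"
    using v by (simp add: ennreal_mult[symmetric] powr_add[symmetric])
  ultimately have "lorentz_norm p r (ball x \<rho>) f \<le> ennreal (v powr (\<kappa> / p) * L)"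
    using L(2) by (simp add: mult.assoc[symmetric] ennreal_mult)
  then have "measure lebesgue {y \<in> ball x \<rho>. l < norm (f y)} \<le> 2 * (2 * (v powr (\<kappa> / p) * L) / l) powr p"
    using p L(2) by (intro lorentz_norm_weak_type[OF _ r f _ l]) auto
  also have "2 * (v powr (\<kappa> / p) * L) / l = (2 * L / l) * v powr (\<kappa> / p)" by simp
  also have "\<dots> powr p = (2 * L / l) powr p * v powr \<kappa>"
    using L(2) l v p by (subst powr_mult) (auto simp: powr_powr)
  also have "2 * ((2 * L / l) powr p * v powr \<kappa>) \<le> 2 powr p * ((2 * L / l) powr p * v powr \<kappa>)"
    using powr_mono[of 1 p 2] p by (intro mult_right_mono) auto
  also have "\<dots> = (4 * L / l) powr p * v powr \<kappa>"
    using L(2) l by (simp add: powr_mult[symmetric])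
  finally show "measure lebesgue {y \<in> ball x \<rho>. l < norm (f y)} \<le> (4 * L / l) powr p * measure lebesgue (ball x \<rho>) powr \<kappa>"
    by (simp add: v_def)
qed

section \<open>Level sets of functions that are weak Morrey and of bounded oscillation\<close>

text \<open>
  The level step (in units of the oscillation bound) that halves the level sets in dimension \<open>n\<close>:
  the factor \<open>unit_ball_vol n * n ^ n\<close> is the volume of the ball of radius \<open>n\<close>, which contains
  every cube of side 1 that contains its centre. Adding 1 makes the step at least 1.
\<close>

definition decay_scale :: "nat \<Rightarrow> real" where
  "decay_scale n = 4 * (1 + 2 ^ (n + 1)) * (unit_ball_vol n * n ^ n) + 1"

text \<open>
  Balls above the critical volume \<open>v\<^sub>0\<close> given by \<open>N powr p * v\<^sub>0 powr (\<kappa> - 1) = b powr p\<close>. There the weak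
  type bound makes the first level set sparse in the surrounding cube, so the decay starts at a
  level comparable to \<open>b\<close>.
\<close>

lemma level_set_bound_large:
  fixes f :: "'a::euclidean_space \<Rightarrow> 'b::{real_normed_vector,second_countable_topology}"
  defines "H \<equiv> decay_scale DIM('a)"
  assumes f: "f \<in> borel_measurable lebesgue" and osc: "bounded_oscillation f b" and b: "b > 0"
    and weak: "weak_morrey p \<kappa> N f" and N: "N > 0" and p: "p \<ge> 1" and \<kappa>: "0 < \<kappa>" "\<kappa> < 1"
    and \<rho>: "\<rho> > 0" and large: "(N / b) powr p \<le> measure lebesgue (ball x \<rho>) powr (1 - \<kappa>)"
  shows "measure lebesgue {y \<in> ball x \<rho>. (real k + 1) * (H * b) < norm (f y)} \<le>
    (2 * DIM('a)) ^ DIM('a) * ((N / b) powr p * measure lebesgue (ball x \<rho>) powr \<kappa>) / 2 ^ k"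
proof -
  define n where "n = DIM('a)"
  define A where "A = measure lebesgue (ball (0::'a) n)"
  define K where "K = 4 * (1 + 2 ^ (n + 1)) * A"
  have n1: "n \<ge> 1" by (simp add: n_def DIM_positive Suc_leI)
  have A: "A = unit_ball_vol n * n ^ n" by (simp add: A_def n_def content_ball)
  have A0: "A > 0" by (simp add: A_def n_def)
  have K0: "K > 0" using A0 by (simp add: K_def add_pos_pos)
  have H: "H = K + 1" by (simp add: H_def decay_scale_def K_def A n_def)
  have H1: "H \<ge> 1" "H > 0" using K0 H by auto
  define v where "v = measure lebesgue (ball x \<rho>)"
  have v0: "v > 0" using \<rho> by (simp add: v_def)
  \<comment> \<open>the grid is placed such that the cell of side \<open>2 * \<rho>\<close> around \<open>x\<close> is centred at \<open>x\<close>\<close>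
  define a where "a = x - \<rho> *\<^sub>R One"
  define Q where "Q = grid_cell a (2 * \<rho>) x"
  define B' where "B' = ball x (n * (2 * \<rho>))"
  define E where "E l = {y \<in> Q. l < norm (f y)}" for l
  have QB': "Q \<subseteq> B'" using \<rho> by (simp add: Q_def B'_def n_def grid_cell_subset_ball)
  have BQ: "ball x \<rho> \<subseteq> Q"
  proof
    fix y assume y: "y \<in> ball x \<rho>"
    have fl: "\<lfloor>(z - a) \<bullet> i / (2 * \<rho>)\<rfloor> = 0" if "i \<in> Basis" "z \<in> ball x \<rho>" for i z
    proof -
      have "\<bar>(z - x) \<bullet> i\<bar> < \<rho>"
        using Basis_le_norm[OF that(1), of "z - x"] that(2) by (simp add: dist_norm norm_minus_commute)
      moreover have "(z - a) \<bullet> i = (z - x) \<bullet> i + \<rho>"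
        using that(1) by (simp add: a_def inner_add_left inner_diff_left)
      ultimately show ?thesis using \<rho> by (simp add: floor_eq_iff)
    qed
    then show "y \<in> Q" using y \<rho> by (simp add: Q_def grid_cell_def)
  qed
  have Ql: "Q \<in> lmeasurable" using \<rho> by (simp add: Q_def lmeasurable_grid_cell)
  have Es: "E l \<in> lmeasurable" for l
    unfolding E_def by (rule fmeasurableI2[OF Ql _ level_set_sets[OF f fmeasurableD[OF Ql]]]) blast
  have vB': "measure lebesgue B' = A * (2 * \<rho>) ^ n"
    unfolding B'_def A_def n_def using \<rho> by (intro measure_ball_scale) auto
  have vB'2: "measure lebesgue B' = (2 * n) ^ n * v"
    using \<rho> by (simp add: B'_def v_def content_ball n_def power_mult_distrib)
  have nn1: "(2 * real n) ^ n \<ge> 1" using n1 by (intro one_le_power) simp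
  have Eweak: "measure lebesgue (E l) \<le> (N / l) powr p * measure lebesgue B' powr \<kappa>" if "l > 0" for l
  proof -
    have lms: "{y \<in> B'. l < norm (f y)} \<in> lmeasurable"
      by (rule fmeasurableI2[OF lmeasurable_ball _ level_set_sets[OF f], of B']) (auto simp: B'_def)
    have "measure lebesgue (E l) \<le> measure lebesgue {y \<in> B'. l < norm (f y)}"
      using QB' by (intro measure_mono_fmeasurable lms fmeasurableD[OF Es]) (auto simp: E_def)
    also have "\<dots> \<le> (N / l) powr p * measure lebesgue B' powr \<kappa>"
      using weak that \<rho> n1 unfolding weak_morrey_def B'_def by simp
    finally show ?thesis .
  qed
  have NH: "(N / (H * b)) powr p \<le> (N / b) powr p / H"
  proof -
    have "(N / (H * b)) powr p = (N / b * (1 / H)) powr p" by (simp add: mult.commute)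
    also have "\<dots> = (N / b) powr p / H powr p"
      using N b H1 by (subst powr_mult) (auto simp: powr_divide)
    also have "\<dots> \<le> (N / b) powr p / H"
      using powr_mono[of 1 p H] p H1 by (intro divide_left_mono) auto
    finally show ?thesis .
  qed
  have small: "measure lebesgue (E (H * b)) \<le> (2 * \<rho>) ^ n / 2 ^ (n + 2)"
  proof -
    let ?V = "measure lebesgue B'"
    have V: "?V \<ge> v" "?V > 0" using mult_right_mono[OF nn1, of v] v0 vB'2 by auto
    have "measure lebesgue (E (H * b)) \<le> (N / (H * b)) powr p * ?V powr \<kappa>"
      using H1 b by (intro Eweak) auto
    also have "\<dots> \<le> (v powr (1 - \<kappa>) / H) * ?V powr \<kappa>"
    proof (rule mult_right_mono)
      have "(N / b) powr p / H \<le> v powr (1 - \<kappa>) / H"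
        using large H1 by (intro divide_right_mono) (auto simp only: v_def)
      then show "(N / (H * b)) powr p \<le> v powr (1 - \<kappa>) / H" using NH by linarith
    qed simp
    also have "\<dots> \<le> (?V powr (1 - \<kappa>) / H) * ?V powr \<kappa>"
      using V v0 \<kappa> H1 by (intro mult_right_mono divide_right_mono powr_mono2) auto
    also have "\<dots> = ?V / H" using V by (simp add: powr_add[symmetric])
    also have "\<dots> = A * (2 * \<rho>) ^ n / H" by (simp only: vB')
    also have "\<dots> \<le> A * (2 * \<rho>) ^ n / (2 ^ (n + 2) * A)"
    proof (rule divide_left_mono)
      have "2 ^ (n + 2) * A \<le> K" using A0 by (simp add: K_def algebra_simps)
      then show "2 ^ (n + 2) * A \<le> H" using H by simp
    qed (use A0 \<rho> H1 in auto)
    also have "\<dots> = (2 * \<rho>) ^ n / 2 ^ (n + 2)" using A0 by simp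
    finally show ?thesis .
  qed
  have decay: "measure lebesgue (E (H * b + k * (K * b))) \<le> measure lebesgue (E (H * b)) / 2 ^ k"
    unfolding E_def
  proof (rule level_set_decay[OF f osc b _ Q_def])
    show "0 < 2 * \<rho>" using \<rho> by simp
    show "K = 4 * (1 + 2 ^ (DIM('a) + 1)) * measure lebesgue (ball (0::'a) DIM('a))"
      by (simp only: K_def A_def n_def)
    show "measure lebesgue {y \<in> Q. H * b < norm (f y)} \<le> (2 * \<rho>) ^ DIM('a) / 2 ^ (DIM('a) + 2)"
      using small unfolding E_def n_def .
  qed
  have sub: "{y \<in> ball x \<rho>. (real k + 1) * (H * b) < norm (f y)} \<subseteq> E (H * b + k * (K * b))"
  proof -
    have "real k * (K * b) \<le> real k * (H * b)" using H b by (intro mult_left_mono mult_right_mono) auto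
    then have "H * b + k * (K * b) \<le> (real k + 1) * (H * b)" by (simp add: distrib_right)
    then show ?thesis using BQ by (auto simp: E_def)
  qed
  have "measure lebesgue {y \<in> ball x \<rho>. (real k + 1) * (H * b) < norm (f y)} \<le> measure lebesgue (E (H * b + k * (K * b)))"
    by (rule measure_mono_fmeasurable[OF sub level_set_sets[OF f] Es]) simp
  also note decay
  also have "measure lebesgue (E (H * b)) \<le> (N / (H * b)) powr p * measure lebesgue B' powr \<kappa>"
    using H1 b by (intro Eweak) auto
  also have "\<dots> \<le> (N / b) powr p * ((2 * n) ^ n * v powr \<kappa>)"
  proof (rule mult_mono)
    have "(N / b) powr p / H \<le> (N / b) powr p / 1" using H1 by (intro divide_left_mono) auto
    then show "(N / (H * b)) powr p \<le> (N / b) powr p" using NH by simp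
    have "measure lebesgue B' powr \<kappa> = ((2 * n) ^ n) powr \<kappa> * v powr \<kappa>"
      using v0 by (simp only: vB'2) (simp add: powr_mult)
    also have "\<dots> \<le> (2 * n) ^ n * v powr \<kappa>"
      using powr_mono[of \<kappa> 1 "(2 * real n) ^ n"] nn1 \<kappa> by (intro mult_right_mono) auto
    finally show "measure lebesgue B' powr \<kappa> \<le> (2 * n) ^ n * v powr \<kappa>" .
  qed auto
  finally have "measure lebesgue {y \<in> ball x \<rho>. (real k + 1) * (H * b) < norm (f y)} \<le>
    (N / b) powr p * ((2 * n) ^ n * v powr \<kappa>) / 2 ^ k"
    by (simp only: divide_right_mono zero_le_power zero_le_numeral)
  then show ?thesis by (simp only: v_def n_def mult_ac)
qed

lemma ball_of_measure:
  fixes x :: "'a::euclidean_space"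
  assumes "v > 0"
  obtains \<rho> where "\<rho> > 0" "measure lebesgue (ball x \<rho>) = v"
proof
  define w where "w = unit_ball_vol DIM('a)"
  have w: "w > 0" by (simp add: w_def)
  show "(v / w) powr (1 / DIM('a)) > 0" using assms w by simp
  have "((v / w) powr (1 / DIM('a))) ^ DIM('a) = v / w"
    using assms w by (simp add: powr_realpow[symmetric] powr_powr)
  then show "measure lebesgue (ball x ((v / w) powr (1 / DIM('a)))) = v"
    using w by (simp add: content_ball flip: w_def)
qed

text \<open>
  The same bound for all balls, with slower decay. A ball below the critical volume is compared with
  the concentric ball of critical volume, and the resulting bound is interpolated with the trivial
  bound by the volume of the ball.
\<close>

lemma level_set_bound:
  fixes f :: "'a::euclidean_space \<Rightarrow> 'b::{real_normed_vector,second_countable_topology}"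
  defines "H \<equiv> decay_scale DIM('a)"
  assumes f: "f \<in> borel_measurable lebesgue" and osc: "bounded_oscillation f b" and b: "b > 0"
    and weak: "weak_morrey p \<kappa> N f" and N: "N > 0" and p: "p \<ge> 1" and \<kappa>: "0 < \<kappa>" "\<kappa> < 1"
    and \<rho>: "\<rho> > 0"
  shows "measure lebesgue {y \<in> ball x \<rho>. (real k + 1) * (H * b) < norm (f y)} \<le>
    (2 * DIM('a)) ^ DIM('a) * ((N / b) powr p * measure lebesgue (ball x \<rho>) powr \<kappa>) * (2 powr (\<kappa> - 1)) ^ k"
proof (cases "(N / b) powr p \<le> measure lebesgue (ball x \<rho>) powr (1 - \<kappa>)")
  case True
  have "measure lebesgue {y \<in> ball x \<rho>. (real k + 1) * (H * b) < norm (f y)} \<le>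
    (2 * DIM('a)) ^ DIM('a) * ((N / b) powr p * measure lebesgue (ball x \<rho>) powr \<kappa>) * (1/2) ^ k"
    using level_set_bound_large[OF f osc b weak N p \<kappa> \<rho> True, of k]
    unfolding H_def[symmetric] by (simp only: power_one_over times_divide_eq_right mult_1_right)
  also have "\<dots> \<le> (2 * DIM('a)) ^ DIM('a) * ((N / b) powr p * measure lebesgue (ball x \<rho>) powr \<kappa>) * (2 powr (\<kappa> - 1)) ^ k"
  proof (intro mult_left_mono power_mono)
    show "1 / 2 \<le> (2::real) powr (\<kappa> - 1)" using powr_mono[of "-1" "\<kappa> - 1" "2::real"] \<kappa> by (simp add: powr_minus_divide)
  qed auto
  finally show ?thesis .
next
  case False
  define v where "v = measure lebesgue (ball x \<rho>)"
  define v\<^sub>0 where "v\<^sub>0 = (N / b) powr (p / (1 - \<kappa>))"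
  define C where "C = real ((2 * DIM('a)) ^ DIM('a))"
  define X where "X = measure lebesgue {y \<in> ball x \<rho>. (real k + 1) * (H * b) < norm (f y)}"
  have v: "v > 0" using \<rho> by (simp add: v_def)
  have v0: "v\<^sub>0 > 0" using N b by (simp add: v\<^sub>0_def)
  have v0\<kappa>: "v\<^sub>0 powr (1 - \<kappa>) = (N / b) powr p" using \<kappa> by (simp add: v\<^sub>0_def powr_powr)
  have "DIM('a) \<ge> 1" by (simp add: DIM_positive Suc_leI)
  then have "(2 * DIM('a)) ^ DIM('a) \<ge> 1" by (intro one_le_power) linarith
  then have C1: "C \<ge> 1" unfolding C_def by linarith
  obtain \<rho>\<^sub>0 where \<rho>0: "\<rho>\<^sub>0 > 0" "measure lebesgue (ball x \<rho>\<^sub>0) = v\<^sub>0"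
    using ball_of_measure[OF v0] by blast
  have "v powr (1 - \<kappa>) < v\<^sub>0 powr (1 - \<kappa>)" using False by (simp only: v_def v0\<kappa>)
  then have "v < v\<^sub>0" using \<kappa> v v0 by (meson diff_gt_0_iff_gt less_le_not_le linorder_not_le powr_mono2)
  then have "\<rho> \<le> \<rho>\<^sub>0"
    using \<rho>0 measure_mono_fmeasurable[OF subset_ball[of \<rho>\<^sub>0 \<rho> x], of lebesgue] by (force simp: v_def)
  then have sub: "{y \<in> ball x \<rho>. (real k + 1) * (H * b) < norm (f y)} \<subseteq> {y \<in> ball x \<rho>\<^sub>0. (real k + 1) * (H * b) < norm (f y)}"
    using subset_ball by fastforce
  have ms: "{y \<in> ball x r. l < norm (f y)} \<in> lmeasurable" for r l
    by (rule fmeasurableI2[OF lmeasurable_ball _ level_set_sets[OF f]]) auto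
  have X0: "X \<ge> 0" by (simp add: X_def)
  have Xv: "X \<le> v"
    unfolding X_def v_def by (rule measure_mono_fmeasurable[OF _ fmeasurableD[OF ms]]) auto
  have "X \<le> measure lebesgue {y \<in> ball x \<rho>\<^sub>0. (real k + 1) * (H * b) < norm (f y)}"
    unfolding X_def by (rule measure_mono_fmeasurable[OF sub fmeasurableD[OF ms] ms])
  also have "\<dots> \<le> C * ((N / b) powr p * measure lebesgue (ball x \<rho>\<^sub>0) powr \<kappa>) / 2 ^ k"
    unfolding H_def C_def by (rule level_set_bound_large[OF f osc b weak N p \<kappa> \<rho>0(1)]) (simp only: \<rho>0(2) v0\<kappa> order_refl)
  also have "(N / b) powr p * measure lebesgue (ball x \<rho>\<^sub>0) powr \<kappa> = v\<^sub>0"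
    using v0 by (simp only: \<rho>0(2) v0\<kappa>[symmetric]) (simp add: powr_add[symmetric])
  finally have Xv0: "X \<le> C * v\<^sub>0 / 2 ^ k" .
  have "X = X powr \<kappa> * X powr (1 - \<kappa>)" using X0 by (simp add: powr_add[symmetric])
  also have "\<dots> \<le> v powr \<kappa> * (C * v\<^sub>0 / 2 ^ k) powr (1 - \<kappa>)"
    using X0 Xv Xv0 \<kappa> by (intro mult_mono powr_mono2) auto
  also have "(C * v\<^sub>0 / 2 ^ k) powr (1 - \<kappa>) = C powr (1 - \<kappa>) * v\<^sub>0 powr (1 - \<kappa>) / (2 ^ k) powr (1 - \<kappa>)"
    using C1 v0 by (simp add: powr_mult powr_divide)
  also have "\<dots> = C powr (1 - \<kappa>) * (N / b) powr p * (2 powr (\<kappa> - 1)) ^ k"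
  proof -
    have "(2 powr (\<kappa> - 1)) ^ k * ((2::real) ^ k) powr (1 - \<kappa>) = 1"
      by (simp add: powr_realpow[symmetric] powr_powr powr_add[symmetric] algebra_simps)
    then show ?thesis unfolding v0\<kappa> by (simp add: field_simps)
  qed
  also have "v powr \<kappa> * \<dots> \<le> v powr \<kappa> * (C * (N / b) powr p * (2 powr (\<kappa> - 1)) ^ k)"
    using powr_mono[of "1 - \<kappa>" 1 C] C1 \<kappa> by (intro mult_left_mono mult_right_mono) auto
  finally show ?thesis by (simp only: X_def v_def C_def mult_ac)
qed

section \<open>The interpolation inequality between Morrey norm and bounded oscillation\<close>

lemma nn_integral_shells:
  assumes A: "\<And>j. A j \<in> fmeasurable M" and S: "S \<in> sets M"
    and g: "\<And>y. y \<in> S \<Longrightarrow> g y = 0 \<or> (\<exists>j. y \<in> A j \<and> g y \<le> c j)"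
    and c: "\<And>j. c j \<ge> 0" and d: "\<And>j. c j * measure M (A j) \<le> d j" and sm: "d sums s"
  shows "(\<integral>\<^sup>+y\<in>S. ennreal (g y) \<partial>M) \<le> ennreal s"
proof -
  have d0: "d j \<ge> 0" for j using c d[of j] by (meson measure_nonneg mult_nonneg_nonneg order_trans)
  have "(\<integral>\<^sup>+y\<in>S. ennreal (g y) \<partial>M) \<le> (\<integral>\<^sup>+y. (\<Sum>j. ennreal (c j) * indicator (A j) y) \<partial>M)"
  proof (intro nn_integral_mono)
    fix y
    show "ennreal (g y) * indicator S y \<le> (\<Sum>j. ennreal (c j) * indicator (A j) y)"
    proof (cases "y \<in> S \<and> g y \<noteq> 0")
      case True
      then obtain j where j: "y \<in> A j" "g y \<le> c j" using g by blast
      have "ennreal (g y) * indicator S y \<le> ennreal (c j) * indicator (A j) y"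
        using True j by (simp add: ennreal_leI)
      also have "\<dots> = (\<Sum>i\<in>{j}. ennreal (c i) * indicator (A i) y)" by (subst sum.insert; simp)
      also have "\<dots> \<le> (\<Sum>j. ennreal (c j) * indicator (A j) y)"
        by (rule sum_le_suminf) auto
      finally show ?thesis .
    qed auto
  qed
  also have "\<dots> = (\<Sum>j. \<integral>\<^sup>+y. ennreal (c j) * indicator (A j) y \<partial>M)"
    using A by (intro nn_integral_suminf) (simp add: fmeasurableD)
  also have "\<dots> = (\<Sum>j. ennreal (c j * measure M (A j)))"
    using A c by (simp add: nn_integral_cmult_indicator fmeasurableD emeasure_eq_measure2 ennreal_mult)
  also have "\<dots> \<le> (\<Sum>j. ennreal (d j))"
    by (intro suminf_le ennreal_leI d) auto
  also have "\<dots> = ennreal s"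
    by (rule suminf_ennreal_eq[OF d0 sm])
  finally show ?thesis .
qed

lemma powr_sum_superadditive:
  fixes x y a :: real
  assumes "x \<ge> 0" "y \<ge> 0" "a \<ge> 1"
  shows "x powr a + y powr a \<le> (x + y) powr a"
proof (cases "x + y = 0")
  case False
  then have s: "x + y > 0" using assms by simp
  have *: "t powr a \<le> t * (x + y) powr (a - 1)" if "0 \<le> t" "t \<le> x + y" for t
  proof (cases "t = 0")
    case False
    then have "t powr a = t * t powr (a - 1)" using that by (simp add: powr_mult_base)
    then show ?thesis using that assms by (auto intro!: mult_left_mono powr_mono2)
  qed simp
  have "x powr a + y powr a \<le> (x + y) * (x + y) powr (a - 1)"
    using *[of x] *[of y] assms by (simp add: distrib_right)
  also have "\<dots> = (x + y) powr a" using s by (simp add: powr_mult_base)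
  finally show ?thesis .
qed (use assms in \<open>auto simp: add_nonneg_eq_0_iff\<close>)

lemma low_level_integral:
  fixes f :: "'a::euclidean_space \<Rightarrow> 'b::{real_normed_vector,second_countable_topology}"
  assumes f: "f \<in> borel_measurable lebesgue" and B: "B \<in> lmeasurable"
    and T: "T > 0" and p: "p \<ge> 1" and V: "V \<ge> 0"
    and weak: "\<And>l. l > 0 \<Longrightarrow> measure lebesgue {y \<in> B. l < norm (f y)} \<le> (T / l) powr p * V"
  shows "(\<integral>\<^sup>+y\<in>{y \<in> B. norm (f y) \<le> T}. ennreal (norm (f y) powr (2 * p)) \<partial>lebesgue)
    \<le> ennreal ((2 * T) powr (2 * p) * V)"
proof -
  define A where "A j = {y \<in> B. T / 2 ^ Suc j < norm (f y) \<and> norm (f y) \<le> T / 2 ^ j}" for j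
  define c where "c j = (T / 2 ^ j) powr (2 * p)" for j :: nat
  have ms: "{y \<in> B. l < norm (f y)} \<in> lmeasurable" for l
    by (rule fmeasurableI2[OF B _ level_set_sets[OF f fmeasurableD[OF B]]]) auto
  have A_eq: "A j = {y \<in> B. T / 2 ^ Suc j < norm (f y)} - {y \<in> B. T / 2 ^ j < norm (f y)}" for j
    by (auto simp: A_def)
  have A: "A j \<in> lmeasurable" for j unfolding A_eq by (intro fmeasurable.Diff ms)
  have S_eq: "{y \<in> B. norm (f y) \<le> T} = B - {y \<in> B. T < norm (f y)}" by auto
  have S: "{y \<in> B. norm (f y) \<le> T} \<in> sets lebesgue"
    unfolding S_eq by (intro sets.Diff fmeasurableD ms B)
  have "c j * measure lebesgue (A j) \<le> (2 powr p * T powr (2 * p) * V) * (1/2) ^ j" for j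
  proof -
    have "measure lebesgue (A j) \<le> measure lebesgue {y \<in> B. T / 2 ^ Suc j < norm (f y)}"
      by (rule measure_mono_fmeasurable[OF _ fmeasurableD[OF A] ms]) (auto simp: A_def)
    also have "\<dots> \<le> (T / (T / 2 ^ Suc j)) powr p * V" using T by (intro weak) auto
    also have "T / (T / 2 ^ Suc j) = 2 * 2 ^ j" using T by simp
    also have "(2 * 2 ^ j :: real) powr p = 2 powr p * (2 ^ j) powr p" by (simp add: powr_mult)
    finally have "c j * measure lebesgue (A j) \<le> c j * (2 powr p * (2 ^ j) powr p * V)"
      by (intro mult_left_mono) (auto simp: c_def)
    also have "\<dots> = (2 powr p * T powr (2 * p) * V) / (2 ^ j) powr p"
    proof -
      have "c j = T powr (2 * p) / ((2 ^ j) powr p * (2 ^ j) powr p)"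
        using T by (simp add: c_def powr_divide powr_add[symmetric])
      then show ?thesis by (simp add: field_simps)
    qed
    also have "\<dots> \<le> (2 powr p * T powr (2 * p) * V) / 2 ^ j"
      using powr_mono[of 1 p "2 ^ j :: real"] p V by (intro divide_left_mono) auto
    finally show ?thesis by (simp add: power_one_over)
  qed
  moreover have "norm (f y) powr (2 * p) = 0 \<or> (\<exists>j. y \<in> A j \<and> norm (f y) powr (2 * p) \<le> c j)"
    if y: "y \<in> {y \<in> B. norm (f y) \<le> T}" for y
  proof (cases "f y = 0")
    case False
    then have "norm (f y) / T > 0" using T by simp
    then obtain n where "(1/2::real) ^ n < norm (f y) / T" using real_arch_pow_inv[of _ "1/2"] by auto
    then have ex: "\<exists>j. T / 2 ^ j < norm (f y)" using T
      by (intro exI[of _ n]) (simp add: power_one_over field_simps)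
    define i where "i = (LEAST j. T / 2 ^ j < norm (f y))"
    have i: "T / 2 ^ i < norm (f y)" unfolding i_def using ex by (rule LeastI_ex)
    then have "i \<noteq> 0" using y by (intro notI) simp
    then obtain j where j: "i = Suc j" using not0_implies_Suc by blast
    have "\<not> T / 2 ^ j < norm (f y)" using not_less_Least[of j] j by (metis i_def lessI)
    then have "y \<in> A j" "norm (f y) powr (2 * p) \<le> c j"
      using i j y p by (auto simp: A_def c_def intro!: powr_mono2)
    then show ?thesis by blast
  qed (use p in simp)
  moreover have "(\<lambda>j. (2 powr p * T powr (2 * p) * V) * (1/2) ^ j) sums (2 powr p * T powr (2 * p) * V * 2)"
    using geometric_sums[of "1/2::real"] by (intro sums_mult) simp
  ultimately have "(\<integral>\<^sup>+y\<in>{y \<in> B. norm (f y) \<le> T}. ennreal (norm (f y) powr (2 * p)) \<partial>lebesgue)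
    \<le> ennreal (2 powr p * T powr (2 * p) * V * 2)"
    by (intro nn_integral_shells[OF A S, where c = c]) (auto simp: c_def)
  also have "\<dots> \<le> ennreal ((2 * T) powr (2 * p) * V)"
  proof (rule ennreal_leI)
    have "2 powr p * 2 \<le> 2 powr p * (2::real) powr p" using powr_mono[of 1 p "2::real"] p by simp
    also have "\<dots> = 2 powr (2 * p)" by (simp add: powr_add[symmetric])
    finally have "2 powr p * 2 * (T powr (2 * p) * V) \<le> 2 powr (2 * p) * (T powr (2 * p) * V)"
      using V by (intro mult_right_mono) auto
    then show "2 powr p * T powr (2 * p) * V * 2 \<le> (2 * T) powr (2 * p) * V"
      using T by (simp add: powr_mult mult_ac)
  qed
  finally show ?thesis .
qed

text \<open>
  With \<open>a = 2 * p\<close> and fixed \<open>e\<close> the factor \<open>(a / e) powr a\<close> is the source of the linear dependence on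
  \<open>p\<close> of the norm estimate.
\<close>

lemma powr_le_exp:
  fixes x a :: real
  assumes "x > 0" "a > 0" "e > 0"
  shows "x powr a \<le> (a / e) powr a * exp (e * x)"
proof -
  have "e * x / a \<le> exp (e * x / a)"
    using exp_ge_add_one_self[of "e * x / a"] by linarith
  then have "x \<le> a / e * exp (e * x / a)" using assms by (simp add: field_simps)
  then have "x powr a \<le> (a / e * exp (e * x / a)) powr a" using assms by (intro powr_mono2) auto
  also have "\<dots> = (a / e) powr a * exp (e * x)"
    using assms by (subst powr_mult) (auto simp: exp_powr_real)
  finally show ?thesis .
qed

lemma high_level_integral:
  fixes f :: "'a::euclidean_space \<Rightarrow> 'b::{real_normed_vector,second_countable_topology}"
  assumes f: "f \<in> borel_measurable lebesgue" and B: "B \<in> lmeasurable"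
    and T: "T > 0" and p: "p \<ge> 1" and V: "V \<ge> 0" and e: "e > 0"
    and lev: "\<And>k::nat. measure lebesgue {y \<in> B. (real k + 1) * T < norm (f y)} \<le> V * exp (- (2 * e)) ^ k"
  shows "(\<integral>\<^sup>+y\<in>{y \<in> B. T < norm (f y)}. ennreal (norm (f y) powr (2 * p)) \<partial>lebesgue)
    \<le> ennreal ((2 * p / e * T) powr (2 * p) * (V * (exp (2 * e) / (1 - exp (- e)))))"
proof -
  define A where "A k = {y \<in> B. (real k + 1) * T < norm (f y) \<and> norm (f y) \<le> (real k + 2) * T}" for k :: nat
  define c where "c k = ((real k + 2) * T) powr (2 * p)" for k :: nat
  define D where "D = (2 * p / e * T) powr (2 * p) * (V * exp (2 * e))"
  have ms: "{y \<in> B. l < norm (f y)} \<in> lmeasurable" for l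
    by (rule fmeasurableI2[OF B _ level_set_sets[OF f fmeasurableD[OF B]]]) auto
  have A_eq: "A k = {y \<in> B. (real k + 1) * T < norm (f y)} - {y \<in> B. (real k + 2) * T < norm (f y)}" for k
    by (auto simp: A_def)
  have A: "A k \<in> lmeasurable" for k unfolding A_eq by (intro fmeasurable.Diff ms)
  have S: "{y \<in> B. T < norm (f y)} \<in> sets lebesgue" by (intro fmeasurableD ms)
  have "c k * measure lebesgue (A k) \<le> D * exp (- e) ^ k" for k
  proof -
    have "measure lebesgue (A k) \<le> measure lebesgue {y \<in> B. (real k + 1) * T < norm (f y)}"
      by (rule measure_mono_fmeasurable[OF _ fmeasurableD[OF A] ms]) (auto simp: A_def)
    also note lev
    finally have "c k * measure lebesgue (A k) \<le> c k * (V * exp (- (2 * e)) ^ k)"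
      by (intro mult_left_mono) (auto simp: c_def)
    also have "\<dots> \<le> ((2 * p / e) powr (2 * p) * exp (e * (real k + 2)) * T powr (2 * p)) * (V * exp (- (2 * e)) ^ k)"
    proof (rule mult_right_mono)
      have "c k = (real k + 2) powr (2 * p) * T powr (2 * p)" using T by (simp add: c_def powr_mult)
      also have "\<dots> \<le> ((2 * p / e) powr (2 * p) * exp (e * (real k + 2))) * T powr (2 * p)"
        using p e by (intro mult_right_mono powr_le_exp) auto
      finally show "c k \<le> (2 * p / e) powr (2 * p) * exp (e * (real k + 2)) * T powr (2 * p)" .
    qed (use V in auto)
    also have "\<dots> = D * (exp (e * k) * exp (- (2 * e)) ^ k)"
    proof -
      have "(2 * p / e * T) powr (2 * p) = (2 * p / e) powr (2 * p) * T powr (2 * p)"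
        by (simp only: powr_mult)
      then show ?thesis unfolding D_def by (simp add: distrib_left exp_add mult_ac)
    qed
    also have "exp (e * k) * exp (- (2 * e)) ^ k = exp (- e) ^ k"
      by (simp add: exp_of_nat_mult[symmetric] exp_add[symmetric] algebra_simps)
    finally show ?thesis .
  qed
  moreover have "\<exists>k. y \<in> A k \<and> norm (f y) powr (2 * p) \<le> c k"
    if y: "y \<in> {y \<in> B. T < norm (f y)}" for y
  proof -
    define z where "z = norm (f y) / T"
    have z: "z > 1" using y T by (simp add: z_def)
    define k where "k = nat (\<lceil>z\<rceil> - 2)"
    have "\<lceil>z\<rceil> \<ge> 2" using z by linarith
    then have k: "real k = \<lceil>z\<rceil> - 2" by (simp add: k_def)
    have "real k + 1 < z" "z \<le> real k + 2" using k by linarith+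
    then have "(real k + 1) * T < norm (f y)" "norm (f y) \<le> (real k + 2) * T"
      using T by (simp_all add: z_def field_simps)
    then have "y \<in> A k" "norm (f y) powr (2 * p) \<le> c k"
      using y p by (auto simp: A_def c_def intro!: powr_mono2)
    then show ?thesis by blast
  qed
  moreover have "(\<lambda>k. D * exp (- e) ^ k) sums (D * (1 / (1 - exp (- e))))"
    using e by (intro sums_mult geometric_sums) simp
  ultimately have "(\<integral>\<^sup>+y\<in>{y \<in> B. T < norm (f y)}. ennreal (norm (f y) powr (2 * p)) \<partial>lebesgue)
    \<le> ennreal (D * (1 / (1 - exp (- e))))"
    by (intro nn_integral_shells[OF A S, where c = c]) (auto simp: c_def)
  then show ?thesis by (simp add: D_def mult_ac)
qed


text \<open>
  The constant of the interpolation inequality below. The number \<open>e\<close> is half the exponential decay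
  rate of the level sets: \<open>exp (- (2 * e)) = 2 powr (\<kappa> - 1)\<close>.
\<close>

definition interpolation_const :: "nat \<Rightarrow> real \<Rightarrow> real" where
  "interpolation_const n \<kappa> =
     (let e = ln 2 * (1 - \<kappa>) / 2 in
      decay_scale n * (2 + 2 * (1 + (2 * n) ^ n * (exp (2 * e) / (1 - exp (- e)))) / e))"

lemma decay_scale_ge_1: "decay_scale n \<ge> 1"
  by (simp add: decay_scale_def)

lemma interpolation_const_pos:
  assumes "\<kappa> < 1"
  shows "interpolation_const n \<kappa> > 0"
proof -
  define e where "e = ln 2 * (1 - \<kappa>) / 2"
  have e: "e > 0" using assms by (simp add: e_def)
  then have "2 + 2 * (1 + (2 * n) ^ n * (exp (2 * e) / (1 - exp (- e)))) / e > 0"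
    by (intro add_pos_nonneg divide_nonneg_pos mult_nonneg_nonneg add_nonneg_nonneg) auto
  then show ?thesis
    using decay_scale_ge_1[of n] by (simp add: interpolation_const_def Let_def flip: e_def)
qed

text \<open>
  In terms of norms, \<open>f\<close> has Morrey norm with exponents \<open>2 * p\<close> and \<open>\<kappa>\<close> at most \<open>C * p * sqrt (N * b)\<close>.
  The levels below a multiple \<open>T\<close> of \<open>b\<close> are controlled by the weak type bound alone, those above by the exponential decay.
\<close>

lemma morrey_bmo_interpolation:
  fixes f :: "'a::euclidean_space \<Rightarrow> 'b::{real_normed_vector,second_countable_topology}"
  assumes f: "f \<in> borel_measurable lebesgue" and osc: "bounded_oscillation f b" and b: "b > 0"
    and weak: "weak_morrey p \<kappa> N f" and N: "N > 0" and p: "p \<ge> 1" and \<kappa>: "0 < \<kappa>" "\<kappa> < 1"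
    and \<rho>: "\<rho> > 0"
  shows "(\<integral>\<^sup>+y\<in>ball x \<rho>. ennreal (norm (f y) powr (2 * p)) \<partial>lebesgue) \<le>
    ennreal ((interpolation_const DIM('a) \<kappa> * p) powr (2 * p) * ((N * b) powr p * measure lebesgue (ball x \<rho>) powr \<kappa>))"
proof -
  define H where "H = decay_scale DIM('a)"
  define e where "e = ln 2 * (1 - \<kappa>) / 2"
  define D where "D = real ((2 * DIM('a)) ^ DIM('a))"
  define C where "C = D * (exp (2 * e) / (1 - exp (- e)))"
  define v where "v = measure lebesgue (ball x \<rho>)"
  define W where "W = (N / b) powr p * v powr \<kappa>"
  define T where "T = H * b"
  let ?B = "ball x \<rho>"
  have H: "H \<ge> 1" by (simp add: H_def decay_scale_ge_1)
  have T: "T > 0" using H b by (simp add: T_def)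
  have e: "e > 0" using \<kappa> by (simp add: e_def)
  have W: "W \<ge> 0" by (simp add: W_def)
  have C: "C \<ge> 0" using e by (simp add: C_def D_def)
  have B: "?B \<in> lmeasurable" by simp
  have q: "exp (- (2 * e)) = 2 powr (\<kappa> - 1)" by (simp add: e_def powr_def field_simps)
  have low: "(\<integral>\<^sup>+y\<in>{y \<in> ?B. norm (f y) \<le> T}. ennreal (norm (f y) powr (2 * p)) \<partial>lebesgue)
    \<le> ennreal ((2 * T) powr (2 * p) * W)"
  proof (rule low_level_integral[OF f B T p W])
    fix l :: real assume l: "l > 0"
    have "measure lebesgue {y \<in> ?B. l < norm (f y)} \<le> (N / l) powr p * v powr \<kappa>"
      using weak l \<rho> unfolding weak_morrey_def v_def by simp
    also have "\<dots> \<le> (T / l * (N / b)) powr p * v powr \<kappa>"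
      using l N H b p by (intro mult_right_mono powr_mono2) (auto simp: T_def field_simps)
    also have "\<dots> = (T / l) powr p * W"
      using l N T b by (subst powr_mult) (auto simp: W_def)
    finally show "measure lebesgue {y \<in> ?B. l < norm (f y)} \<le> (T / l) powr p * W" .
  qed
  have lev: "measure lebesgue {y \<in> ?B. (real k + 1) * T < norm (f y)} \<le> (D * W) * exp (- (2 * e)) ^ k" for k
    using level_set_bound[OF f osc b weak N p \<kappa> \<rho>, where k = k]
    by (simp only: q D_def W_def v_def T_def H_def)
  have "(\<integral>\<^sup>+y\<in>{y \<in> ?B. T < norm (f y)}. ennreal (norm (f y) powr (2 * p)) \<partial>lebesgue)
    \<le> ennreal ((2 * p / e * T) powr (2 * p) * ((D * W) * (exp (2 * e) / (1 - exp (- e)))))"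
    by (rule high_level_integral[OF f B T p _ e lev]) (simp add: D_def W)
  also have "\<dots> \<le> ennreal ((2 * (1 + C) / e * p * T) powr (2 * p) * W)"
  proof (rule ennreal_leI)
    have "(D * W) * (exp (2 * e) / (1 - exp (- e))) = C * W" by (simp add: C_def)
    moreover have "C \<le> (1 + C) powr (2 * p)"
      using powr_mono[of 1 "2 * p" "1 + C"] C p by simp
    then have "C * W \<le> (1 + C) powr (2 * p) * W" using W by (rule mult_right_mono)
    ultimately have "(2 * p / e * T) powr (2 * p) * ((D * W) * (exp (2 * e) / (1 - exp (- e))))
        \<le> (2 * p / e * T) powr (2 * p) * ((1 + C) powr (2 * p) * W)"
      by (metis mult_left_mono powr_ge_zero)
    also have "\<dots> = ((2 * p / e * T) * (1 + C)) powr (2 * p) * W"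
      using p e T C by (subst powr_mult) auto
    also have "(2 * p / e * T) * (1 + C) = 2 * (1 + C) / e * p * T" by simp
    finally show "(2 * p / e * T) powr (2 * p) * ((D * W) * (exp (2 * e) / (1 - exp (- e))))
        \<le> (2 * (1 + C) / e * p * T) powr (2 * p) * W" .
  qed
  finally have high: "(\<integral>\<^sup>+y\<in>{y \<in> ?B. T < norm (f y)}. ennreal (norm (f y) powr (2 * p)) \<partial>lebesgue)
    \<le> ennreal ((2 * (1 + C) / e * p * T) powr (2 * p) * W)" .
  have sets: "{y \<in> ?B. T < norm (f y)} \<in> sets lebesgue" "{y \<in> ?B. norm (f y) \<le> T} \<in> sets lebesgue"
  proof -
    show *: "{y \<in> ?B. T < norm (f y)} \<in> sets lebesgue" by (rule level_set_sets[OF f]) simp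
    have "?B - {y \<in> ?B. T < norm (f y)} \<in> sets lebesgue" by (intro sets.Diff * fmeasurableD B)
    moreover have "{y \<in> ?B. norm (f y) \<le> T} = ?B - {y \<in> ?B. T < norm (f y)}" by auto
    ultimately show "{y \<in> ?B. norm (f y) \<le> T} \<in> sets lebesgue" by (simp only:)
  qed
  have g: "(\<lambda>y. ennreal (norm (f y) powr (2 * p))) \<in> borel_measurable lebesgue"
    using f by measurable
  have "(\<integral>\<^sup>+y\<in>?B. ennreal (norm (f y) powr (2 * p)) \<partial>lebesgue) =
      (\<integral>\<^sup>+y. ennreal (norm (f y) powr (2 * p)) * indicator {y \<in> ?B. norm (f y) \<le> T} y +
            ennreal (norm (f y) powr (2 * p)) * indicator {y \<in> ?B. T < norm (f y)} y \<partial>lebesgue)"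
    by (intro nn_integral_cong) (auto simp: indicator_def)
  also have "\<dots> = (\<integral>\<^sup>+y\<in>{y \<in> ?B. norm (f y) \<le> T}. ennreal (norm (f y) powr (2 * p)) \<partial>lebesgue) +
      (\<integral>\<^sup>+y\<in>{y \<in> ?B. T < norm (f y)}. ennreal (norm (f y) powr (2 * p)) \<partial>lebesgue)"
    using sets g by (intro nn_integral_add borel_measurable_times_ennreal borel_measurable_indicator) auto
  also have "\<dots> \<le> ennreal ((2 * T) powr (2 * p) * W) + ennreal ((2 * (1 + C) / e * p * T) powr (2 * p) * W)"
    by (rule add_mono[OF low high])
  also have "\<dots> = ennreal (((2 * T) powr (2 * p) + (2 * (1 + C) / e * p * T) powr (2 * p)) * W)"
    using W by (simp add: distrib_right)
  also have "\<dots> \<le> ennreal ((interpolation_const DIM('a) \<kappa> * p * b) powr (2 * p) * W)"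
  proof (intro ennreal_leI mult_right_mono W)
    have "(2 * T) powr (2 * p) + (2 * (1 + C) / e * p * T) powr (2 * p) \<le>
        (2 * T + 2 * (1 + C) / e * p * T) powr (2 * p)"
      using T C e p by (intro powr_sum_superadditive) auto
    also have "\<dots> \<le> (2 * p * T + 2 * (1 + C) / e * p * T) powr (2 * p)"
      using T C e p by (intro powr_mono2) auto
    also have "2 * p * T + 2 * (1 + C) / e * p * T = interpolation_const DIM('a) \<kappa> * p * b"
    proof -
      have "interpolation_const DIM('a) \<kappa> = H * (2 + 2 * (1 + C) / e)"
        by (simp add: interpolation_const_def Let_def e_def D_def C_def H_def)
      then show ?thesis by (simp add: T_def algebra_simps)
    qed
    finally show "(2 * T) powr (2 * p) + (2 * (1 + C) / e * p * T) powr (2 * p) \<le>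
        (interpolation_const DIM('a) \<kappa> * p * b) powr (2 * p)" .
  qed
  also have "(interpolation_const DIM('a) \<kappa> * p * b) powr (2 * p) * W =
      (interpolation_const DIM('a) \<kappa> * p) powr (2 * p) * ((N * b) powr p * v powr \<kappa>)"
  proof -
    have "b powr (2 * p) * (N / b) powr p = (N * b) powr p"
      using N b powr_add[of b p p] by (simp add: powr_mult powr_divide)
    moreover have "(interpolation_const DIM('a) \<kappa> * p * b) powr (2 * p) =
        (interpolation_const DIM('a) \<kappa> * p) powr (2 * p) * b powr (2 * p)"
      by (simp only: powr_mult)
    ultimately show ?thesis unfolding W_def by (metis mult.assoc)
  qed
  finally show ?thesis by (simp only: v_def)
qed

section \<open>Products\<close>

lemma nn_integral_product_powr:
  fixes F G :: "'a::euclidean_space \<Rightarrow> 'b::{real_normed_field,banach,second_countable_topology}"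
  assumes F: "F \<in> borel_measurable lebesgue" and G: "G \<in> borel_measurable lebesgue" and B: "B \<in> sets lebesgue"
    and X: "(\<integral>\<^sup>+y\<in>B. ennreal (norm (F y) powr (2 * p)) \<partial>lebesgue) \<le> ennreal X" "X \<ge> 0"
    and Y: "(\<integral>\<^sup>+y\<in>B. ennreal (norm (G y) powr (2 * p)) \<partial>lebesgue) \<le> ennreal Y" "Y \<ge> 0"
  shows "(\<integral>\<^sup>+y\<in>B. ennreal (norm (F y * G y) powr p) \<partial>lebesgue) \<le> ennreal (sqrt (X * Y))"
proof -
  define h where "h u y = ennreal (norm (u y) powr p) * indicator B y" for u :: "'a \<Rightarrow> 'b" and y
  have h: "h u \<in> borel_measurable lebesgue" if "u \<in> borel_measurable lebesgue" for u
  proof -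
    have "(\<lambda>y. ennreal (norm (u y) powr p)) \<in> borel_measurable lebesgue" using that by measurable
    then show ?thesis unfolding h_def using B by (intro borel_measurable_times_ennreal borel_measurable_indicator)
  qed
  have sq: "(\<integral>\<^sup>+y. h u y ^ 2 \<partial>lebesgue) = (\<integral>\<^sup>+y\<in>B. ennreal (norm (u y) powr (2 * p)) \<partial>lebesgue)" for u
  proof (intro nn_integral_cong)
    fix y
    have "norm (u y) powr (2 * p) = (norm (u y) powr p)\<^sup>2"
      by (simp add: power2_eq_square powr_add[symmetric])
    then show "h u y ^ 2 = ennreal (norm (u y) powr (2 * p)) * indicator B y"
      by (simp add: h_def power_mult_distrib ennreal_power indicator_def)
  qed
  have "(\<integral>\<^sup>+y\<in>B. ennreal (norm (F y * G y) powr p) \<partial>lebesgue) = (\<integral>\<^sup>+y. h F y * h G y \<partial>lebesgue)"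
    by (intro nn_integral_cong) (simp add: h_def norm_mult powr_mult ennreal_mult indicator_def)
  moreover have "(\<integral>\<^sup>+y. h F y * h G y \<partial>lebesgue)\<^sup>2 \<le> ennreal (X * Y)"
  proof -
    have "(\<integral>\<^sup>+y. h F y * h G y \<partial>lebesgue)\<^sup>2 \<le> (\<integral>\<^sup>+y. h F y ^ 2 \<partial>lebesgue) * (\<integral>\<^sup>+y. h G y ^ 2 \<partial>lebesgue)"
      by (rule Cauchy_Schwarz_nn_integral[OF h[OF F] h[OF G]])
    also have "\<dots> \<le> ennreal X * ennreal Y" unfolding sq by (rule mult_mono[OF X(1) Y(1)]) auto
    also have "\<dots> = ennreal (X * Y)" using X(2) by (simp add: ennreal_mult')
    finally show ?thesis .
  qed
  moreover have "I \<le> ennreal (sqrt (X * Y))" if "I\<^sup>2 \<le> ennreal (X * Y)" for I :: ennreal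
  proof (cases I)
    case (real i)
    then have "i\<^sup>2 \<le> X * Y" using that X(2) Y(2) by (simp add: ennreal_power)
    then show ?thesis using real by (simp add: real_le_rsqrt ennreal_leI)
  next
    case top
    then show ?thesis using that by (simp add: power2_eq_square ennreal_top_mult top_unique)
  qed
  ultimately show ?thesis by metis
qed

text \<open>
  The exponent \<open>\<kappa>\<close> is the mean of \<open>\<kappa>\<^sub>1\<close> and \<open>\<kappa>\<^sub>2\<close> exactly so that the powers of the volume cancel after
  the Cauchy--Schwarz inequality; regrouping \<open>N\<^sub>1 * b\<^sub>1 * N\<^sub>2 * b\<^sub>2\<close> before the inequality between geometric
  and arithmetic mean produces the mixed products.
\<close>

lemma morrey_norm_product_weak:
  fixes F G :: "'a::euclidean_space \<Rightarrow> 'b::{real_normed_field,banach,second_countable_topology}"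
  assumes F: "F \<in> borel_measurable lebesgue" "bounded_oscillation F b\<^sub>1" "b\<^sub>1 > 0" "weak_morrey p \<kappa>\<^sub>1 N\<^sub>1 F" "N\<^sub>1 > 0"
    and G: "G \<in> borel_measurable lebesgue" "bounded_oscillation G b\<^sub>2" "b\<^sub>2 > 0" "weak_morrey p \<kappa>\<^sub>2 N\<^sub>2 G" "N\<^sub>2 > 0"
    and p: "p \<ge> 1" and \<kappa>: "0 < \<kappa>\<^sub>1" "\<kappa>\<^sub>1 < 1" "0 < \<kappa>\<^sub>2" "\<kappa>\<^sub>2 < 1" "\<kappa> = (\<kappa>\<^sub>1 + \<kappa>\<^sub>2) / 2"
  shows "morrey_norm p \<kappa> (\<lambda>x. F x * G x) \<le> ennreal
    (interpolation_const DIM('a) \<kappa>\<^sub>1 * interpolation_const DIM('a) \<kappa>\<^sub>2 * p\<^sup>2 * (N\<^sub>1 * b\<^sub>2 + N\<^sub>2 * b\<^sub>1))"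
  unfolding morrey_norm_def
proof (rule SUP_least)
  fix B :: "'a set" assume "B \<in> balls"
  then obtain x \<rho> where B: "B = ball x \<rho>" "\<rho> > 0" by (auto simp: balls_def)
  define v where "v = measure lebesgue B"
  have v: "v > 0" using B by (simp add: v_def)
  define c\<^sub>1 c\<^sub>2 where "c\<^sub>1 = interpolation_const DIM('a) \<kappa>\<^sub>1" and "c\<^sub>2 = interpolation_const DIM('a) \<kappa>\<^sub>2"
  have c: "c\<^sub>1 > 0" "c\<^sub>2 > 0" using \<kappa> by (simp_all add: c\<^sub>1_def c\<^sub>2_def interpolation_const_pos)
  define X where "X = (c\<^sub>1 * p) powr (2 * p) * ((N\<^sub>1 * b\<^sub>1) powr p * v powr \<kappa>\<^sub>1)"
  define Y where "Y = (c\<^sub>2 * p) powr (2 * p) * ((N\<^sub>2 * b\<^sub>2) powr p * v powr \<kappa>\<^sub>2)"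
  define Z where "Z = (c\<^sub>1 * p) * (c\<^sub>2 * p) * sqrt ((N\<^sub>1 * b\<^sub>1) * (N\<^sub>2 * b\<^sub>2))"
  have Z0: "Z \<ge> 0" using c p F G by (simp add: Z_def)
  let ?I = "\<integral>\<^sup>+y\<in>B. ennreal (norm (F y * G y) powr p) \<partial>lebesgue"
  have "?I \<le> ennreal (sqrt (X * Y))"
  proof (rule nn_integral_product_powr[OF F(1) G(1)])
    show "(\<integral>\<^sup>+y\<in>B. ennreal (norm (F y) powr (2 * p)) \<partial>lebesgue) \<le> ennreal X"
      unfolding X_def v_def c\<^sub>1_def B(1) by (rule morrey_bmo_interpolation[OF F p \<kappa>(1,2) B(2)])
    show "(\<integral>\<^sup>+y\<in>B. ennreal (norm (G y) powr (2 * p)) \<partial>lebesgue) \<le> ennreal Y"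
      unfolding Y_def v_def c\<^sub>2_def B(1) by (rule morrey_bmo_interpolation[OF G p \<kappa>(3,4) B(2)])
  qed (auto simp: B(1) X_def Y_def)
  also have "sqrt (X * Y) = v powr \<kappa> * Z powr p"
  proof (rule real_sqrt_unique)
    have s: "(t powr p)\<^sup>2 = t powr (2 * p)" "(sqrt t powr p)\<^sup>2 = t powr p" if "t > 0" for t :: real
      using that by (simp_all add: power2_eq_square powr_add[symmetric] powr_half_sqrt[symmetric] powr_powr)
    have "\<kappa> + \<kappa> = \<kappa>\<^sub>1 + \<kappa>\<^sub>2" using \<kappa>(5) by simp
    then have "(v powr \<kappa>)\<^sup>2 = v powr \<kappa>\<^sub>1 * v powr \<kappa>\<^sub>2"
      by (simp only: power2_eq_square powr_add[symmetric])
    moreover have "(Z powr p)\<^sup>2 = (c\<^sub>1 * p) powr (2 * p) * (c\<^sub>2 * p) powr (2 * p) * ((N\<^sub>1 * b\<^sub>1) powr p * (N\<^sub>2 * b\<^sub>2) powr p)"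
    proof -
      have "Z powr p = (c\<^sub>1 * p) powr p * (c\<^sub>2 * p) powr p * sqrt ((N\<^sub>1 * b\<^sub>1) * (N\<^sub>2 * b\<^sub>2)) powr p"
        unfolding Z_def by (simp only: powr_mult)
      then have "(Z powr p)\<^sup>2 = ((c\<^sub>1 * p) powr p)\<^sup>2 * ((c\<^sub>2 * p) powr p)\<^sup>2 * (sqrt ((N\<^sub>1 * b\<^sub>1) * (N\<^sub>2 * b\<^sub>2)) powr p)\<^sup>2"
        by (simp only: power_mult_distrib)
      also have "\<dots> = (c\<^sub>1 * p) powr (2 * p) * (c\<^sub>2 * p) powr (2 * p) * ((N\<^sub>1 * b\<^sub>1) * (N\<^sub>2 * b\<^sub>2)) powr p"
        using c p F(3,5) G(3,5) by (simp only: s mult_pos_pos zero_less_one order_less_le_trans)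
      finally show ?thesis by (simp only: powr_mult)
    qed
    ultimately show "(v powr \<kappa> * Z powr p)\<^sup>2 = X * Y"
      by (simp only: X_def Y_def power_mult_distrib mult_ac)
  qed simp
  finally have "ennreal (v powr (- \<kappa>)) * ?I \<le> ennreal (v powr (- \<kappa>)) * ennreal (v powr \<kappa> * Z powr p)"
    by (rule mult_left_mono) simp
  also have "\<dots> = ennreal (Z powr p)"
    using v by (simp add: ennreal_mult[symmetric] mult.assoc[symmetric] powr_add[symmetric])
  also have "\<dots> = ennreal (Z powr (1 / (1 / p)))" by simp
  finally have "epow (ennreal (v powr (- \<kappa>)) * ?I) (1 / p) \<le> ennreal Z"
    using p Z0 by (subst epow_le_ennreal_iff) auto
  also have "\<dots> \<le> ennreal (c\<^sub>1 * c\<^sub>2 * p\<^sup>2 * (N\<^sub>1 * b\<^sub>2 + N\<^sub>2 * b\<^sub>1))"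
  proof (rule ennreal_leI)
    have "sqrt ((N\<^sub>1 * b\<^sub>2) * (N\<^sub>2 * b\<^sub>1)) \<le> (N\<^sub>1 * b\<^sub>2 + N\<^sub>2 * b\<^sub>1) / 2"
      using F G by (intro arith_geo_mean_sqrt) auto
    also have "\<dots> \<le> N\<^sub>1 * b\<^sub>2 + N\<^sub>2 * b\<^sub>1" using F G by simp
    finally have "(c\<^sub>1 * c\<^sub>2 * p\<^sup>2) * sqrt ((N\<^sub>1 * b\<^sub>2) * (N\<^sub>2 * b\<^sub>1)) \<le> (c\<^sub>1 * c\<^sub>2 * p\<^sup>2) * (N\<^sub>1 * b\<^sub>2 + N\<^sub>2 * b\<^sub>1)"
      using c by (intro mult_left_mono) auto
    then show "Z \<le> c\<^sub>1 * c\<^sub>2 * p\<^sup>2 * (N\<^sub>1 * b\<^sub>2 + N\<^sub>2 * b\<^sub>1)"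
      by (simp add: Z_def power2_eq_square mult_ac)
  qed
  finally show "epow (ennreal (measure lebesgue B powr - \<kappa>) * ?I) (1 / p)
      \<le> ennreal (interpolation_const DIM('a) \<kappa>\<^sub>1 * interpolation_const DIM('a) \<kappa>\<^sub>2 * p\<^sup>2 * (N\<^sub>1 * b\<^sub>2 + N\<^sub>2 * b\<^sub>1))"
    by (simp only: v_def c\<^sub>1_def c\<^sub>2_def)
qed

lemma bounded_oscillation_bmo:
  fixes f :: "'a::euclidean_space \<Rightarrow> 'b::{banach,second_countable_topology}"
  assumes "bmo_norm f \<le> ennreal b" "b \<ge> 0"
  shows "bounded_oscillation f b"
  unfolding bounded_oscillation_def
proof (intro allI impI exI)
  fix x :: 'a and \<rho> :: real assume \<rho>: "\<rho> > 0"
  let ?B = "ball x \<rho>" and ?I = "\<integral>\<^sup>+y\<in>ball x \<rho>. ennreal (norm (f y - ball_mean f (ball x \<rho>))) \<partial>lebesgue"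
  define v where "v = measure lebesgue ?B"
  have v: "v > 0" using \<rho> by (simp add: v_def)
  have "?B \<in> balls" using \<rho> by (auto simp: balls_def)
  then have "ennreal (1 / v) * ?I \<le> bmo_norm f"
    unfolding bmo_norm_def v_def by (rule SUP_upper)
  also note assms(1)
  finally have "ennreal v * (ennreal (1 / v) * ?I) \<le> ennreal v * ennreal b" by (rule mult_left_mono) simp
  moreover have "ennreal v * ennreal (1 / v) = 1" using v by (simp add: ennreal_mult[symmetric])
  ultimately show "?I \<le> ennreal (b * measure lebesgue ?B)"
    using v assms(2) by (simp add: mult.assoc[symmetric] ennreal_mult[symmetric] mult.commute flip: v_def)
qed

text \<open>
  On a ball \<open>norm f\<close> is dominated by \<open>1 + norm f powr p\<close>, so a finite Morrey norm implies local integrability.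
\<close>

lemma morrey_memI:
  fixes f :: "'a::euclidean_space \<Rightarrow> 'b::{banach,second_countable_topology}"
  assumes p: "p \<ge> 1" and f: "f \<in> borel_measurable lebesgue" and fin: "morrey_norm p \<kappa> f < \<infinity>"
  shows "f \<in> morrey p \<kappa>"
proof -
  have "set_integrable lebesgue K f" if K: "compact K" for K
  proof -
    obtain R where R: "R > 0" "K \<subseteq> ball 0 R"
      using compact_imp_bounded[OF K] bounded_subset_ballD by blast
    define B where "B = ball (0::'a) R"
    define v where "v = measure lebesgue B"
    have v: "v > 0" using R by (simp add: v_def B_def)
    have "B \<in> balls" using R by (auto simp: balls_def B_def)
    then have "epow (ennreal (v powr (- \<kappa>)) * (\<integral>\<^sup>+y\<in>B. ennreal (norm (f y) powr p) \<partial>lebesgue)) (1 / p)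
        \<le> morrey_norm p \<kappa> f"
      unfolding morrey_norm_def v_def by (rule SUP_upper)
    then have "epow (ennreal (v powr (- \<kappa>)) * (\<integral>\<^sup>+y\<in>B. ennreal (norm (f y) powr p) \<partial>lebesgue)) (1 / p) < \<infinity>"
      using fin by (rule le_less_trans)
    then have "ennreal (v powr (- \<kappa>)) * (\<integral>\<^sup>+y\<in>B. ennreal (norm (f y) powr p) \<partial>lebesgue) < \<infinity>"
      by (auto simp: epow_def less_top split: if_splits)
    then have I: "(\<integral>\<^sup>+y\<in>B. ennreal (norm (f y) powr p) \<partial>lebesgue) < \<infinity>"
      using v by (auto simp: ennreal_mult_less_top)
    have Bs: "B \<in> sets lebesgue" "emeasure lebesgue B < \<infinity>"
      using emeasure_lborel_ball_finite[of "0::'a" R] by (auto simp: B_def)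
    have Ks: "K \<in> sets lebesgue" by (rule fmeasurableD[OF lmeasurable_compact[OF K]])
    have g: "(\<lambda>y. ennreal (norm (f y) powr p)) \<in> borel_measurable lebesgue" using f by measurable
    have "(\<integral>\<^sup>+y. ennreal (norm (indicator K y *\<^sub>R f y)) \<partial>lebesgue) \<le>
        (\<integral>\<^sup>+y. indicator B y + ennreal (norm (f y) powr p) * indicator B y \<partial>lebesgue)"
    proof (intro nn_integral_mono)
      fix y
      have "norm (f y) \<le> 1 + norm (f y) powr p"
      proof (cases "norm (f y) \<le> 1")
        case False
        then have "norm (f y) powr 1 \<le> norm (f y) powr p" using p by (intro powr_mono) auto
        then show ?thesis using False by simp
      qed (simp add: add_increasing2)
      then have "ennreal (norm (f y)) \<le> 1 + ennreal (norm (f y) powr p)"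
        by (metis ennreal_1 ennreal_leI ennreal_plus powr_ge_zero zero_le_one)
      then show "ennreal (norm (indicator K y *\<^sub>R f y)) \<le> indicator B y + ennreal (norm (f y) powr p) * indicator B y"
        using R(2) by (auto simp: indicator_def B_def)
    qed
    also have "\<dots> = emeasure lebesgue B + (\<integral>\<^sup>+y\<in>B. ennreal (norm (f y) powr p) \<partial>lebesgue)"
      using Bs g by (subst nn_integral_add) (auto intro!: borel_measurable_times_ennreal borel_measurable_indicator)
    also have "\<dots> < \<infinity>" using Bs I by simp
    finally show ?thesis
      unfolding set_integrable_def using f Ks
      by (intro integrableI_bounded borel_measurable_scaleR borel_measurable_indicator) auto
  qed
  then show ?thesis using fin by (simp add: morrey_def locally_integrable_def)
qed

theorem mainTheorem7:
  fixes r :: ennreal and \<kappa>\<^sub>1 \<kappa>\<^sub>2 \<kappa> :: real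
  assumes "0 < \<kappa>\<^sub>1" "\<kappa>\<^sub>1 < 1" "0 < \<kappa>\<^sub>2" "\<kappa>\<^sub>2 < 1"
    and "\<kappa> = (\<kappa>\<^sub>1 + \<kappa>\<^sub>2) / 2"
  shows "\<exists>C>0. \<forall>p::real. 1 < p \<and> ennreal p \<le> r \<longrightarrow>
    (\<forall>F G :: real ^ 'n \<Rightarrow> 'b::{real_normed_field, banach, second_countable_topology}.
      F \<in> lorentz_morrey p r \<kappa>\<^sub>1 \<inter> bmo \<longrightarrow> G \<in> lorentz_morrey p r \<kappa>\<^sub>2 \<inter> bmo \<longrightarrow>
      (\<lambda>x. F x * G x) \<in> morrey p \<kappa> \<and>
      morrey_norm p \<kappa> (\<lambda>x. F x * G x) \<le>
        ennreal (C * p\<^sup>2) *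
          (lorentz_morrey_norm p r \<kappa>\<^sub>1 F * bmo_norm G +
           lorentz_morrey_norm p r \<kappa>\<^sub>2 G * bmo_norm F))"
proof -
  define c where "c = interpolation_const DIM(real ^ 'n) \<kappa>\<^sub>1 * interpolation_const DIM(real ^ 'n) \<kappa>\<^sub>2"
  have c: "c > 0" using assms by (simp only: c_def interpolation_const_pos mult_pos_pos)
  show ?thesis
  proof (intro exI[of _ "4 * c"] conjI allI impI)
    show "4 * c > 0" using c by simp
    fix p :: real and F G :: "real ^ 'n \<Rightarrow> 'b"
    assume p: "1 < p \<and> ennreal p \<le> r"
      and F: "F \<in> lorentz_morrey p r \<kappa>\<^sub>1 \<inter> bmo" and G: "G \<in> lorentz_morrey p r \<kappa>\<^sub>2 \<inter> bmo"
    have p1: "p \<ge> 1" using p by simp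
    have "ennreal 1 \<le> ennreal p" using p by (intro ennreal_leI) simp
    then have r: "1 \<le> r" using p by (metis ennreal_1 order_trans)
    have m: "F \<in> borel_measurable lebesgue" "G \<in> borel_measurable lebesgue"
      using F G by (auto simp: lorentz_morrey_def)
    define L\<^sub>1 L\<^sub>2 \<beta>\<^sub>1 \<beta>\<^sub>2 where "L\<^sub>1 = enn2real (lorentz_morrey_norm p r \<kappa>\<^sub>1 F)"
      and "L\<^sub>2 = enn2real (lorentz_morrey_norm p r \<kappa>\<^sub>2 G)"
      and "\<beta>\<^sub>1 = enn2real (bmo_norm F)" and "\<beta>\<^sub>2 = enn2real (bmo_norm G)"
    have fin: "lorentz_morrey_norm p r \<kappa>\<^sub>1 F = ennreal L\<^sub>1" "lorentz_morrey_norm p r \<kappa>\<^sub>2 G = ennreal L\<^sub>2"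
      "bmo_norm F = ennreal \<beta>\<^sub>1" "bmo_norm G = ennreal \<beta>\<^sub>2"
      using F G by (auto simp: L\<^sub>1_def L\<^sub>2_def \<beta>\<^sub>1_def \<beta>\<^sub>2_def lorentz_morrey_def bmo_def)
    have nn: "L\<^sub>1 \<ge> 0" "L\<^sub>2 \<ge> 0" "\<beta>\<^sub>1 \<ge> 0" "\<beta>\<^sub>2 \<ge> 0"
      by (simp_all add: L\<^sub>1_def L\<^sub>2_def \<beta>\<^sub>1_def \<beta>\<^sub>2_def)
    let ?M = "morrey_norm p \<kappa> (\<lambda>x. F x * G x)"
    \<comment> \<open>the norms may vanish, so the estimate is applied with norms enlarged by \<open>\<eta> > 0\<close>, and then \<open>\<eta>\<close> tends to 0\<close>
    define R where "R \<eta> = c * p\<^sup>2 * (4 * (L\<^sub>1 + \<eta>) * (\<beta>\<^sub>2 + \<eta>) + 4 * (L\<^sub>2 + \<eta>) * (\<beta>\<^sub>1 + \<eta>))" for \<eta>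
    have bound: "?M \<le> ennreal (R \<eta>)" if \<eta>: "\<eta> > 0" for \<eta>
    proof -
      have "weak_morrey p \<kappa>\<^sub>1 (4 * (L\<^sub>1 + \<eta>)) F"
        using nn \<eta> fin by (intro lorentz_morrey_weak_type[OF p1 r m(1)]) (auto intro: ennreal_leI)
      moreover have "weak_morrey p \<kappa>\<^sub>2 (4 * (L\<^sub>2 + \<eta>)) G"
        using nn \<eta> fin by (intro lorentz_morrey_weak_type[OF p1 r m(2)]) (auto intro: ennreal_leI)
      moreover have "bounded_oscillation F (\<beta>\<^sub>1 + \<eta>)" "bounded_oscillation G (\<beta>\<^sub>2 + \<eta>)"
        using nn \<eta> fin by (auto intro!: bounded_oscillation_bmo ennreal_leI)
      moreover have "\<beta>\<^sub>1 + \<eta> > 0" "\<beta>\<^sub>2 + \<eta> > 0" "4 * (L\<^sub>1 + \<eta>) > 0" "4 * (L\<^sub>2 + \<eta>) > 0"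
        using nn \<eta> by auto
      ultimately show ?thesis
        using morrey_norm_product_weak[OF m(1) _ _ _ _ m(2) _ _ _ _ p1 assms]
        unfolding R_def c_def by blast
    qed
    have "(R \<longlongrightarrow> R 0) (at_right 0)"
      unfolding R_def by (intro tendsto_intros)
    then have "((\<lambda>\<eta>. ennreal (R \<eta>)) \<longlongrightarrow> ennreal (R 0)) (at_right 0)"
      by (rule tendsto_ennrealI)
    moreover have "eventually (\<lambda>\<eta>. ?M \<le> ennreal (R \<eta>)) (at_right 0)"
      using bound by (auto simp: eventually_at_right_field intro: exI[of _ 1])
    ultimately have "?M \<le> ennreal (R 0)"
      by (rule tendsto_lowerbound) simp
    also have "R 0 = 4 * c * p\<^sup>2 * (L\<^sub>1 * \<beta>\<^sub>2 + L\<^sub>2 * \<beta>\<^sub>1)" by (simp add: R_def algebra_simps)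
    also have "ennreal \<dots> = ennreal (4 * c * p\<^sup>2) * (ennreal L\<^sub>1 * ennreal \<beta>\<^sub>2 + ennreal L\<^sub>2 * ennreal \<beta>\<^sub>1)"
      using nn c by (simp add: ennreal_mult)
    finally show est: "?M \<le> ennreal (4 * c * p\<^sup>2) *
        (lorentz_morrey_norm p r \<kappa>\<^sub>1 F * bmo_norm G + lorentz_morrey_norm p r \<kappa>\<^sub>2 G * bmo_norm F)"
      by (simp only: fin)
    show "(\<lambda>x. F x * G x) \<in> morrey p \<kappa>"
    proof (rule morrey_memI[OF p1])
      show "(\<lambda>x. F x * G x) \<in> borel_measurable lebesgue" using m by (rule borel_measurable_times)
      show "?M < \<infinity>" using bound[of 1] by (simp add: le_less_trans)
    qed
  qed
qed

end
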